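(* Let $\mathfrak{X}$ be a homogeneous tree of degree $q+1$ with $q\ge 2$, with boundary $\Omega$, and let $\tau=\frac{2\pi}{\log q}$. Let $u:\mathfrak{X}\to\mathbb{C}$ be a function and let $z\in\mathbb{R}\setminus(\tau/2)\mathbb{Z}$. Then $u=\mathcal{P}_zF$ on $\mathfrak{X}$ for some $F\in L^2(\Omega)$ if and only if $u\in L^{2,\infty}(\mathfrak{X})$ and $\mathcal{L}u(x)=\gamma(z)u(x)$ for all $x\in\mathfrak{X}$. Moreover, there exists a positive constant $C_z$ such that for all $F\in L^2(\Omega)$, $$\|\mathcal{P}_zF\|_{L^{2,\infty}(\mathfrak{X})}\le C_z\|F\|_{L^2(\Omega)}.$$
   Context: Tree and boundary: $\mathfrak{X}$ is the homogeneous tree of degree $q+1$ ($q\ge2$ an integer), i.e. the connected graph without loops (cycles) in which every vertex has exactly $q+1$ neighbours; $\mathfrak{X}$ is identified with its vertex set, with counting measure and graph distance $d$. Fix a reference vertex $o$ and write $|x|=d(o,x)$. The boundary $\Omega$ is the set of all infinite geodesic rays $\omega=(\omega_0=o,\omega_1,\omega_2,\dots)$ starting at $o$. $\nu$ is the probability measure on $\Omega$ (with the $\sigma$-algebra generated by the sets $E(x)=\{\omega\in\Omega:\omega_{|x|}=x\}$, $x\in\mathfrak X$) invariant under the isometries of $\mathfrak{X}$ fixing $o$; explicitly $\nu(E(x))=\frac{q}{(q+1)q^{|x|}}$ for $|x|\ge1$. $L^{2}(\Omega)$ is taken with respect to $\nu$. Poisson kernel and transform: for $x\in\mathfrak{X}$,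 $\omega\in\Omega$, let $c(x,\omega)$ be the last vertex lying on $\omega$ in the geodesic path from $o$ to $x$, let $h_\omega(x)=2|c(x,\omega)|-|x|$, and $p(x,\omega)=q^{h_\omega(x)}$. For $z\in\mathbb{C}$, $p^{1/2+iz}(x,\omega)=q^{(1/2+iz)h_\omega(x)}$, and $$\mathcal{P}_zF(x)=\int_\Omega p^{1/2+iz}(x,\omega)F(\omega)\,d\nu(\omega),\qquad x\in\mathfrak{X}.$$ Laplacian: $\mathcal{L}u(x)=\frac1{q+1}\sum_{y:\,d(x,y)=1}u(y)$, and $\gamma(z)=\frac{q^{1/2+iz}+q^{1/2-iz}}{q+1}$. Weak $L^2$: $\|u\|_{L^{2,\infty}(\mathfrak{X})}=\sup_{t>0}t\,\big(\#\{x\in\mathfrak{X}:|u(x)|>t\}\big)^{1/2}$, and $L^{2,\infty}(\mathfrak{X})$ is the space of functions for which this is finite. *)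

theory Defs
  imports "HOL-Probability.Probability_Measure"
begin

text \<open>The vertex set is the whole type \<open>'v\<close>; \<open>adj\<close> is the neighbour relation.\<close>

locale homogeneous_tree =
  fixes adj :: "'v \<Rightarrow> 'v \<Rightarrow> bool" and q :: nat
  assumes adj_sym: "adj x y \<Longrightarrow> adj y x"
    and adj_irrefl: "\<not> adj x x"
    and adj_connected: "adj\<^sup>*\<^sup>* x y"
    and no_cycles:
      "\<not> (\<exists>p. length p \<ge> 3 \<and> distinct p \<and> successively adj p \<and> adj (last p) (hd p))"
    and degree: "card {y. adj x y} = q + 1"

definition gdist :: "('v \<Rightarrow> 'v \<Rightarrow> bool) \<Rightarrow> 'v \<Rightarrow> 'v \<Rightarrow> nat" where
  "gdist adj x y = (LEAST n. (adj ^^ n) x y)"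

text \<open>In a tree the geodesic path is unique, so the definite description is proper.\<close>

definition geodesic_path :: "('v \<Rightarrow> 'v \<Rightarrow> bool) \<Rightarrow> 'v \<Rightarrow> 'v \<Rightarrow> 'v list" where
  "geodesic_path adj x y =
    (THE p. p \<noteq> [] \<and> hd p = x \<and> last p = y \<and> successively adj p \<and>
            length p = gdist adj x y + 1)"

definition boundary :: "('v \<Rightarrow> 'v \<Rightarrow> bool) \<Rightarrow> 'v \<Rightarrow> (nat \<Rightarrow> 'v) set" where
  "boundary adj x\<^sub>0 =
    {\<omega>. \<omega> 0 = x\<^sub>0 \<and> (\<forall>m n. m \<le> n \<longrightarrow> gdist adj (\<omega> m) (\<omega> n) = n - m)}"

definition shadow :: "('v \<Rightarrow> 'v \<Rightarrow> bool) \<Rightarrow> 'v \<Rightarrow> 'v \<Rightarrow> (nat \<Rightarrow> 'v) set" where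
  "shadow adj x\<^sub>0 x = {\<omega> \<in> boundary adj x\<^sub>0. \<omega> (gdist adj x\<^sub>0 x) = x}"

text \<open>The values on the shadows determine the probability measure; it is the one invariant
  under the isometries of the tree that fix \<open>x\<^sub>0\<close>.\<close>

definition is_boundary_measure ::
    "('v \<Rightarrow> 'v \<Rightarrow> bool) \<Rightarrow> nat \<Rightarrow> 'v \<Rightarrow> (nat \<Rightarrow> 'v) measure \<Rightarrow> bool" where
  "is_boundary_measure adj q x\<^sub>0 \<nu> \<longleftrightarrow>
     prob_space \<nu> \<and>
     space \<nu> = boundary adj x\<^sub>0 \<and>
     sets \<nu> = sigma_sets (boundary adj x\<^sub>0) (range (shadow adj x\<^sub>0)) \<and>
     (\<forall>x. gdist adj x\<^sub>0 x \<ge> 1 \<longrightarrow>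
        measure \<nu> (shadow adj x\<^sub>0 x) = real q / ((real q + 1) * real q ^ gdist adj x\<^sub>0 x))"

text \<open>Square-integrable functions, not identified up to null sets.\<close>

definition L2 :: "'a measure \<Rightarrow> ('a \<Rightarrow> complex) set" where
  "L2 M = {F \<in> borel_measurable M. integrable M (\<lambda>\<omega>. (cmod (F \<omega>))\<^sup>2)}"

definition L2_norm :: "'a measure \<Rightarrow> ('a \<Rightarrow> complex) \<Rightarrow> real" where
  "L2_norm M F = sqrt (\<integral>\<omega>. (cmod (F \<omega>))\<^sup>2 \<partial>M)"

definition confluence :: "('v \<Rightarrow> 'v \<Rightarrow> bool) \<Rightarrow> 'v \<Rightarrow> 'v \<Rightarrow> (nat \<Rightarrow> 'v) \<Rightarrow> 'v" where
  "confluence adj x\<^sub>0 x \<omega> = last (filter (\<lambda>v. v \<in> range \<omega>) (geodesic_path adj x\<^sub>0 x))"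

definition height :: "('v \<Rightarrow> 'v \<Rightarrow> bool) \<Rightarrow> 'v \<Rightarrow> (nat \<Rightarrow> 'v) \<Rightarrow> 'v \<Rightarrow> int" where
  "height adj x\<^sub>0 \<omega> x =
     2 * int (gdist adj x\<^sub>0 (confluence adj x\<^sub>0 x \<omega>)) - int (gdist adj x\<^sub>0 x)"

text \<open>The power \<open>p\<^bsup>1/2+iz\<^esup>\<close> of the Poisson kernel \<open>p = q\<^bsup>h\<^esup>\<close>.\<close>

definition poisson_kernel_power ::
    "('v \<Rightarrow> 'v \<Rightarrow> bool) \<Rightarrow> nat \<Rightarrow> 'v \<Rightarrow> complex \<Rightarrow> 'v \<Rightarrow> (nat \<Rightarrow> 'v) \<Rightarrow> complex" where
  "poisson_kernel_power adj q x\<^sub>0 z x \<omega> =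
     of_nat q powr ((1/2 + \<i> * z) * of_int (height adj x\<^sub>0 \<omega> x))"

definition poisson_transform ::
    "('v \<Rightarrow> 'v \<Rightarrow> bool) \<Rightarrow> nat \<Rightarrow> 'v \<Rightarrow> (nat \<Rightarrow> 'v) measure \<Rightarrow> complex \<Rightarrow>
     ((nat \<Rightarrow> 'v) \<Rightarrow> complex) \<Rightarrow> 'v \<Rightarrow> complex" where
  "poisson_transform adj q x\<^sub>0 \<nu> z F x =
     (\<integral>\<omega>. poisson_kernel_power adj q x\<^sub>0 z x \<omega> * F \<omega> \<partial>\<nu>)"

definition laplacian :: "('v \<Rightarrow> 'v \<Rightarrow> bool) \<Rightarrow> nat \<Rightarrow> ('v \<Rightarrow> complex) \<Rightarrow> 'v \<Rightarrow> complex" where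
  "laplacian adj q u x = 1 / (of_nat q + 1) * (\<Sum>y | gdist adj x y = 1. u y)"

definition eigenvalue_gamma :: "nat \<Rightarrow> complex \<Rightarrow> complex" where
  "eigenvalue_gamma q z =
     (of_nat q powr (1/2 + \<i> * z) + of_nat q powr (1/2 - \<i> * z)) / (of_nat q + 1)"

definition tau :: "nat \<Rightarrow> real" where
  "tau q = 2 * pi / ln (real q)"

text \<open>The quasi-norm takes values in \<open>[0,\<infinity>]\<close>; the case distinction is needed because \<open>card\<close>
  is \<open>0\<close> on infinite sets.\<close>

definition weak_L2_norm :: "('v \<Rightarrow> complex) \<Rightarrow> ennreal" where
  "weak_L2_norm u =
     (SUP t\<in>{0::real<..}.
        if finite {x. cmod (u x) > t} then ennreal (t * sqrt (real (card {x. cmod (u x) > t})))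
        else \<infinity>)"

definition weak_L2 :: "('v \<Rightarrow> complex) set" where
  "weak_L2 = {u. weak_L2_norm u < \<infinity>}"

end

theory Submission
  imports Defs
begin

text \<open>Write \<open>n\<close> for the distance of a vertex \<open>x\<close> from the root, \<open>w = q\<^sup>2\<^sup>i\<^sup>z\<close>, and \<open>m x\<close> for the mean of \<open>F\<close> over
  the shadow of \<open>x\<close>. The number \<open>w\<close> is unimodular, and the hypothesis on \<open>z\<close> says that \<open>w \<noteq> 1\<close>.
  After multiplication by the powers of \<open>q\<^sup>1\<^sup>/\<^sup>2\<^sup>+\<^sup>i\<^sup>z\<close> with exponents the distances from the root, the kernels at \<open>x\<close> and at its
  parent agree off the shadow of \<open>x\<close>. Hence the renormalised transform \<open>V x = q\<^sup>(\<^sup>1\<^sup>/\<^sup>2\<^sup>+\<^sup>i\<^sup>z\<^sup>)\<^sup>n u x\<close>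
  of \<open>F\<close> satisfies the one-step recursion \<open>V x = V (par x) + \<kappa> w\<^sup>n m x\<close> with a constant \<open>\<kappa> \<noteq> 0\<close>
  (\<open>potential_transform\<close>). For arbitrary functions this recursion lets \<open>u\<close> and \<open>m\<close> determine each
  other, and \<open>u\<close> is an eigenfunction exactly when \<open>m\<close> is a martingale along the tree
  (\<open>eigenfunction_iff_martingale\<close>). The theorem thereby becomes a statement about martingales:
  \<open>u\<close> lies in weak \<open>L\<^sup>2\<close> if and only if \<open>m\<close> is bounded in \<open>L\<^sup>2\<close>, and such martingales are the
  sequences of means of square-integrable functions on the boundary.

  From \<open>L\<^sup>2\<close> to weak \<open>L\<^sup>2\<close>: since \<open>w \<noteq> 1\<close>, summation by parts turns the recursion into
  \<open>V x = \<kappa> / (w - 1) (w\<^sup>n\<^sup>+\<^sup>1 m x - S x)\<close>, where \<open>S\<close> is the martingale whose increments are those of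
  \<open>m\<close> multiplied by the unimodular numbers \<open>w\<^sup>n\<close>. By orthogonality of increments \<open>S\<close> is bounded in
  \<open>L\<^sup>2\<close> together with \<open>m\<close>, so \<open>u\<close> is dominated by \<open>q\<^sup>-\<^sup>n\<^sup>/\<^sup>2 (\<bar>m\<bar> + \<bar>S\<bar>)\<close>. It remains to count the
  vertices where an \<open>L\<^sup>2\<close>-bounded martingale exceeds \<open>t q\<^sup>n\<^sup>/\<^sup>2\<close>. On level \<open>n\<close> they are controlled by the
  submartingale \<open>max (\<bar>m\<bar> - t q\<^sup>n\<^sup>/\<^sup>2 / 2) 0\<close>, which may be evaluated on one far level common to
  all \<open>n\<close>; there the sum over \<open>n\<close> is a geometric series (\<open>weak_type_martingale\<close>).

  From weak \<open>L\<^sup>2\<close> to \<open>L\<^sup>2\<close>: by the layer-cake argument the sum of \<open>\<bar>u\<bar>\<^sup>2\<close> over the ball of radius \<open>N\<close> is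
  \<open>O(N)\<close>. As \<open>\<bar>m x\<bar> \<le> (\<bar>V x\<bar> + \<bar>V (par x)\<bar>) / \<bar>\<kappa>\<bar>\<close>, the energies of \<open>m\<close> on the levels are bounded on
  average, and being increasing they are bounded (\<open>energy_le_of_weak_L2_bound\<close>). Orthogonality of
  increments then yields the boundary function as an \<open>L\<^sup>2\<close> limit (\<open>L2_bounded_martingale_closed\<close>).\<close>

section \<open>Rooted homogeneous trees\<close>

locale rooted_tree = homogeneous_tree adj q
  for adj :: "'v \<Rightarrow> 'v \<Rightarrow> bool" and q :: nat +
  fixes x\<^sub>0 :: 'v
  assumes q_ge_2: "q \<ge> 2"
begin

definition lev :: "'v \<Rightarrow> nat" where
  "lev x = gdist adj x\<^sub>0 x"

definition par :: "'v \<Rightarrow> 'v" where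
  "par x = (THE y. adj x y \<and> lev x = Suc (lev y))"

definition children :: "'v \<Rightarrow> 'v set" where
  "children x = {y. adj x y \<and> lev y = Suc (lev x)}"

definition level :: "nat \<Rightarrow> 'v set" where
  "level n = {x. lev x = n}"

lemma relpowp_gdist: "(adj ^^ gdist adj x y) x y"
proof -
  obtain n where "(adj ^^ n) x y"
    using adj_connected[of x y] rtranclp_imp_relpowp by metis
  then show ?thesis
    unfolding gdist_def by (rule LeastI)
qed

lemma gdist_le: "(adj ^^ n) x y \<Longrightarrow> gdist adj x y \<le> n"
  unfolding gdist_def by (rule Least_le)

lemma gdist_eq_0_iff [simp]: "gdist adj x y = 0 \<longleftrightarrow> x = y"
  using relpowp_gdist[of x y] gdist_le[of 0 x y] by auto

lemma gdist_eq_1_iff: "gdist adj x y = 1 \<longleftrightarrow> adj x y"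
proof
  assume "gdist adj x y = 1"
  then show "adj x y"
    using relpowp_gdist[of x y] by (simp only: relpowp_1)
next
  assume a: "adj x y"
  then have "gdist adj x y \<le> 1"
    by (intro gdist_le) (simp only: relpowp_1)
  moreover have "gdist adj x y \<noteq> 0"
    using a adj_irrefl by auto
  ultimately show "gdist adj x y = 1"
    by linarith
qed

lemma lev_root [simp]: "lev x\<^sub>0 = 0"
  by (simp add: lev_def)

lemma lev_eq_0_iff [simp]: "lev x = 0 \<longleftrightarrow> x = x\<^sub>0"
  by (auto simp: lev_def)

lemma lev_adj_le: "adj x y \<Longrightarrow> lev y \<le> Suc (lev x)"
  unfolding lev_def using relpowp_gdist[of x\<^sub>0 x]
  by (intro gdist_le) (auto intro: relpowp_Suc_I)

lemma ex_closer_neighbour: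
  assumes "lev x = Suc n"
  shows "\<exists>y. adj x y \<and> lev y = n"
proof -
  have "(adj ^^ Suc n) x\<^sub>0 x"
    using relpowp_gdist[of x\<^sub>0 x] assms by (simp add: lev_def)
  then obtain y where y: "(adj ^^ n) x\<^sub>0 y" "adj y x"
    by (rule relpowp_Suc_E)
  have "lev y \<le> n"
    using gdist_le[OF y(1)] by (simp add: lev_def)
  moreover have "lev y \<ge> n"
    using lev_adj_le[OF y(2)] assms by simp
  ultimately show ?thesis
    using adj_sym[OF y(2)] by auto
qed

text \<open>Descend from both vertices towards the root until the two descents meet. The bound on the levels
  is what later allows one more vertex to be added to the path without losing simplicity.\<close>

lemma ex_path_within_ball:
  assumes "lev y = n" "lev y' = n" "y \<noteq> y'"
  shows "\<exists>p. length p \<ge> 3 \<and> distinct p \<and> successively adj p \<and> hd p = y \<and> last p = y' \<and>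
             (\<forall>v\<in>set p. lev v \<le> n)"
  using assms
proof (induction n arbitrary: y y')
  case 0
  then show ?case by simp
next
  case (Suc n)
  obtain a where a: "adj y a" "lev a = n"
    using ex_closer_neighbour Suc.prems by blast
  obtain b where b: "adj y' b" "lev b = n"
    using ex_closer_neighbour Suc.prems by blast
  show ?case
  proof (cases "a = b")
    case True
    then show ?thesis
      using a b Suc.prems adj_sym[OF b(1)]
      by (intro exI[of _ "[y, a, y']"]) auto
  next
    case False
    then obtain p where p: "length p \<ge> 3" "distinct p" "successively adj p" "hd p = a" "last p = b"
      "\<forall>v\<in>set p. lev v \<le> n"
      using Suc.IH a(2) b(2) by metis
    have "y \<notin> set p" "y' \<notin> set p"
      using p(6) Suc.prems by auto
    moreover have "p \<noteq> []"
      using p(1) by auto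
    ultimately show ?thesis
      using p a b Suc.prems adj_sym[OF b(1)]
      by (intro exI[of _ "y # p @ [y']"])
         (auto simp: successively_append_iff successively_Cons)
  qed
qed

text \<open>An edge inside a level would close the path of \<open>ex_path_within_ball\<close> to a cycle.\<close>

lemma lev_adj_neq:
  assumes "adj x y"
  shows "lev x \<noteq> lev y"
proof
  assume eq: "lev x = lev y"
  have "x \<noteq> y"
    using assms adj_irrefl by auto
  then obtain p where "length p \<ge> 3" "distinct p" "successively adj p" "hd p = x" "last p = y"
    using ex_path_within_ball[of x "lev y" y] eq by metis
  then show False
    using no_cycles adj_sym[OF assms] by metis
qed

text \<open>Two neighbours closer to the root, joined inside their ball, would form a cycle through \<open>x\<close>.\<close>

lemma closer_neighbour_unique:
  assumes "adj x y" "adj x y'" "lev x = Suc (lev y)" "lev x = Suc (lev y')"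
  shows "y = y'"
proof (rule ccontr)
  assume "y \<noteq> y'"
  then obtain p where p: "length p \<ge> 3" "distinct p" "successively adj p" "hd p = y" "last p = y'"
    "\<forall>v\<in>set p. lev v \<le> lev y"
    using ex_path_within_ball[of y "lev y" y'] assms by auto
  have "x \<notin> set p" "p \<noteq> []"
    using p assms by auto
  then have "length (x # p) \<ge> 3 \<and> distinct (x # p) \<and> successively adj (x # p) \<and>
             adj (last (x # p)) (hd (x # p))"
    using p assms adj_sym[OF assms(2)] by (auto simp: successively_Cons)
  then show False
    using no_cycles by blast
qed

lemma par:
  assumes "x \<noteq> x\<^sub>0"
  shows adj_par: "adj x (par x)" and lev_par: "lev x = Suc (lev (par x))"
proof -
  obtain n where "lev x = Suc n"
    using assms lev_eq_0_iff not0_implies_Suc by blast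
  then have "\<exists>y. adj x y \<and> lev x = Suc (lev y)"
    using ex_closer_neighbour by fastforce
  then have "\<exists>!y. adj x y \<and> lev x = Suc (lev y)"
    using closer_neighbour_unique by blast
  then have "adj x (par x) \<and> lev x = Suc (lev (par x))"
    unfolding par_def by (rule theI')
  then show "adj x (par x)" "lev x = Suc (lev (par x))"
    by auto
qed

lemma par_eqI: "adj x y \<Longrightarrow> lev x = Suc (lev y) \<Longrightarrow> par x = y"
  using closer_neighbour_unique[of x y "par x"] par[of x] by (metis lev_root nat.distinct(1))

text \<open>The children sets are the fibres of \<open>par\<close> away from the root; this makes them a partition of
  the non-root vertices.\<close>

lemma mem_children_iff: "y \<in> children x \<longleftrightarrow> y \<noteq> x\<^sub>0 \<and> par y = x"
  using par[of y] par_eqI[of y x] adj_sym[of x y] adj_sym[of y x] by (auto simp: children_def)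

lemma children_imp: 
  assumes "y \<in> children x"
  shows "y \<noteq> x\<^sub>0" "par y = x" "lev y = Suc (lev x)"
  using assms mem_children_iff par(2) by auto

lemma finite_neighbours: "finite {y. adj x y}"
  using degree[of x] card.infinite by fastforce

lemma finite_children [simp]: "finite (children x)"
  by (rule finite_subset[OF _ finite_neighbours[of x]]) (auto simp: children_def)

lemma neighbours_root: "{y. adj x\<^sub>0 y} = children x\<^sub>0"
  using lev_adj_le[of x\<^sub>0] lev_adj_neq[of x\<^sub>0] by (force simp: children_def le_Suc_eq)

lemma neighbours:
  assumes "x \<noteq> x\<^sub>0"
  shows "{y. adj x y} = insert (par x) (children x)" "par x \<notin> children x"
proof -
  have "y = par x \<or> lev y = Suc (lev x)" if "adj x y" for y
    using lev_adj_le[OF that] lev_adj_le[OF adj_sym[OF that]] lev_adj_neq[OF that]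
      par_eqI[OF that] by (metis le_SucE le_antisym)
  then show "{y. adj x y} = insert (par x) (children x)"
    using adj_par[OF assms] by (auto simp: children_def)
  show "par x \<notin> children x"
    using lev_par[OF assms] by (auto simp: children_def)
qed

lemma card_children_root: "card (children x\<^sub>0) = q + 1"
  using degree[of x\<^sub>0] neighbours_root by simp

lemma card_children: "x \<noteq> x\<^sub>0 \<Longrightarrow> card (children x) = q"
  using degree[of x] neighbours[of x] by simp

lemma level_0: "level 0 = {x\<^sub>0}"
  by (auto simp: level_def)

lemma level_Suc: "level (Suc n) = (\<Union>x\<in>level n. children x)"
proof (intro equalityI subsetI)
  fix y assume y: "y \<in> level (Suc n)"
  then have "y \<noteq> x\<^sub>0"
    by (auto simp: level_def)
  then show "y \<in> (\<Union>x\<in>level n. children x)"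
    using y lev_par[of y] mem_children_iff[of y] by (auto simp: level_def)
qed (auto simp: level_def children_imp(3))

lemma finite_level [simp]: "finite (level n)"
  by (induction n) (simp_all add: level_0 level_Suc)

lemma sum_level_Suc:
  fixes f :: "'v \<Rightarrow> 'a::comm_monoid_add"
  shows "sum f (level (Suc n)) = (\<Sum>x\<in>level n. \<Sum>y\<in>children x. f y)"
  unfolding level_Suc using mem_children_iff
  by (intro sum.UNION_disjoint) auto

section \<open>Geodesics, rays and confluence points\<close>

definition geodesic_to :: "'v list \<Rightarrow> 'v \<Rightarrow> bool" where
  "geodesic_to p x \<longleftrightarrow> p \<noteq> [] \<and> hd p = x\<^sub>0 \<and> last p = x \<and> successively adj p \<and>
     length p = lev x + 1"

lemma lev_last_less_length:
  "p \<noteq> [] \<Longrightarrow> hd p = x\<^sub>0 \<Longrightarrow> successively adj p \<Longrightarrow> lev (last p) < length p"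
proof (induction p rule: rev_induct)
  case (snoc y p)
  show ?case
  proof (cases "p = []")
    case False
    with snoc have "lev (last p) < length p" "adj (last p) y"
      by (auto simp: successively_append_iff)
    then show ?thesis
      using lev_adj_le by fastforce
  qed (use snoc in auto)
qed simp

lemma geodesic_to_root: "geodesic_to p x\<^sub>0 \<longleftrightarrow> p = [x\<^sub>0]"
  by (cases p) (auto simp: geodesic_to_def)

text \<open>A vertex sequence of minimal length can only reach \<open>x\<close> through its unique neighbour closer to the root.
  Existence, uniqueness and the recursive shape of geodesics all follow.\<close>

lemma geodesic_to_step:
  assumes "x \<noteq> x\<^sub>0"
  shows "geodesic_to p x \<longleftrightarrow> (\<exists>p'. p = p' @ [x] \<and> geodesic_to p' (par x))"
proof
  assume p: "geodesic_to p x"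
  then have "p = butlast p @ [x]"
    using append_butlast_last_id[of p] by (simp add: geodesic_to_def)
  then obtain p' where p': "p = p' @ [x]"
    by blast
  have ne: "p' \<noteq> []"
    using p lev_par[OF assms] by (auto simp: geodesic_to_def p')
  then have s: "successively adj p'" "adj (last p') x" "hd p' = x\<^sub>0" "length p' = lev x"
    using p by (auto simp: geodesic_to_def p' successively_append_iff)
  have "lev (last p') < lev x"
    using lev_last_less_length[OF ne s(3) s(1)] s(4) by simp
  then have "lev x = Suc (lev (last p'))"
    using lev_adj_le[OF s(2)] by simp
  then have "last p' = par x"
    using par_eqI[OF adj_sym[OF s(2)]] by simp
  then show "\<exists>p'. p = p' @ [x] \<and> geodesic_to p' (par x)"
    using p' ne s lev_par[OF assms] by (auto simp: geodesic_to_def)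
next
  assume "\<exists>p'. p = p' @ [x] \<and> geodesic_to p' (par x)"
  then show "geodesic_to p x"
    using adj_sym[OF adj_par[OF assms]] lev_par[OF assms]
    by (auto simp: geodesic_to_def successively_append_iff)
qed

lemma ex1_geodesic_to: "\<exists>!p. geodesic_to p x"
proof (induction "lev x" arbitrary: x)
  case 0
  then show ?case by (simp add: geodesic_to_root)
next
  case (Suc n)
  then have x: "x \<noteq> x\<^sub>0" by auto
  then have "\<exists>!p. geodesic_to p (par x)"
    using Suc lev_par[OF x] by simp
  then show ?case
    unfolding geodesic_to_step[OF x] by auto
qed

lemma geodesic_path_eq: "geodesic_path adj x\<^sub>0 x = (THE p. geodesic_to p x)"
  by (simp add: geodesic_path_def geodesic_to_def lev_def)

lemma geodesic_path_root: "geodesic_path adj x\<^sub>0 x\<^sub>0 = [x\<^sub>0]"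
  by (simp add: geodesic_path_eq geodesic_to_root)

lemma geodesic_path_step:
  assumes "x \<noteq> x\<^sub>0"
  shows "geodesic_path adj x\<^sub>0 x = geodesic_path adj x\<^sub>0 (par x) @ [x]"
proof -
  have "geodesic_to (geodesic_path adj x\<^sub>0 (par x)) (par x)"
    unfolding geodesic_path_eq using ex1_geodesic_to by (rule theI')
  then have "geodesic_to (geodesic_path adj x\<^sub>0 (par x) @ [x]) x"
    using geodesic_to_step[OF assms] by blast
  then show ?thesis
    unfolding geodesic_path_eq[of x] by (rule the1_equality[OF ex1_geodesic_to])
qed

lemma boundary_ray:
  assumes "\<omega> \<in> boundary adj x\<^sub>0"
  shows "\<omega> 0 = x\<^sub>0" "lev (\<omega> n) = n" "par (\<omega> (Suc n)) = \<omega> n"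
proof -
  show 0: "\<omega> 0 = x\<^sub>0"
    using assms by (simp add: boundary_def)
  have d: "gdist adj (\<omega> m) (\<omega> n) = n - m" if "m \<le> n" for m n
    using assms that by (simp add: boundary_def)
  have l: "lev (\<omega> n) = n" for n
    using d[of 0 n] 0 by (simp add: lev_def)
  then show "lev (\<omega> n) = n" .
  have "adj (\<omega> n) (\<omega> (Suc n))"
    using d[of n "Suc n"] gdist_eq_1_iff[of "\<omega> n" "\<omega> (Suc n)"] by simp
  then show "par (\<omega> (Suc n)) = \<omega> n"
    using par_eqI[OF adj_sym] l by simp
qed

lemma mem_shadow_iff: "\<omega> \<in> shadow adj x\<^sub>0 x \<longleftrightarrow> \<omega> \<in> boundary adj x\<^sub>0 \<and> \<omega> (lev x) = x"
  by (simp add: shadow_def lev_def)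

lemma shadow_root: "shadow adj x\<^sub>0 x\<^sub>0 = boundary adj x\<^sub>0"
  by (auto simp: mem_shadow_iff boundary_ray(1))

lemma mem_range_iff_shadow:
  "\<omega> \<in> boundary adj x\<^sub>0 \<Longrightarrow> x \<in> range \<omega> \<longleftrightarrow> \<omega> \<in> shadow adj x\<^sub>0 x"
  using boundary_ray(2)[of \<omega>] by (auto simp: mem_shadow_iff) (metis rangeI)

lemma shadow_eq_Union_children: "shadow adj x\<^sub>0 x = (\<Union>y\<in>children x. shadow adj x\<^sub>0 y)"
proof (intro equalityI subsetI)
  fix \<omega> assume w: "\<omega> \<in> shadow adj x\<^sub>0 x"
  then have b: "\<omega> \<in> boundary adj x\<^sub>0" "\<omega> (lev x) = x"
    by (auto simp: mem_shadow_iff)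
  have "\<omega> (Suc (lev x)) \<in> children x"
    using boundary_ray(2,3)[OF b(1)] b(2) mem_children_iff
    by (metis lev_root nat.distinct(1))
  then show "\<omega> \<in> (\<Union>y\<in>children x. shadow adj x\<^sub>0 y)"
    by (rule UN_I) (simp add: b boundary_ray(2)[OF b(1)] mem_shadow_iff)
next
  fix \<omega> assume "\<omega> \<in> (\<Union>y\<in>children x. shadow adj x\<^sub>0 y)"
  then obtain y where "y \<in> children x" "\<omega> \<in> boundary adj x\<^sub>0" "\<omega> (lev y) = y"
    by (auto simp: mem_shadow_iff)
  then show "\<omega> \<in> shadow adj x\<^sub>0 x"
    using children_imp[of y x] boundary_ray(3)[of \<omega> "lev x"] by (simp add: mem_shadow_iff)
qed

lemma shadow_par: "x \<noteq> x\<^sub>0 \<Longrightarrow> shadow adj x\<^sub>0 x \<subseteq> shadow adj x\<^sub>0 (par x)"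
  using shadow_eq_Union_children[of "par x"] mem_children_iff by blast

lemma disjoint_shadow:
  "lev x = lev y \<Longrightarrow> x \<noteq> y \<Longrightarrow> shadow adj x\<^sub>0 x \<inter> shadow adj x\<^sub>0 y = {}"
  by (auto simp: mem_shadow_iff)

lemma boundary_eq_Union_level: "boundary adj x\<^sub>0 = (\<Union>x\<in>level n. shadow adj x\<^sub>0 x)"
  using boundary_ray(2)[of _ n] by (auto simp: mem_shadow_iff level_def)

lemma confluence_root:
  "\<omega> \<in> boundary adj x\<^sub>0 \<Longrightarrow> confluence adj x\<^sub>0 x\<^sub>0 \<omega> = x\<^sub>0"
  using mem_range_iff_shadow[of \<omega> x\<^sub>0] shadow_root by (simp add: confluence_def geodesic_path_root)

lemma confluence_shadow:
  assumes "\<omega> \<in> shadow adj x\<^sub>0 x"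
  shows "confluence adj x\<^sub>0 x \<omega> = x"
proof (cases "x = x\<^sub>0")
  case True
  then show ?thesis
    using assms confluence_root by (simp add: mem_shadow_iff)
next
  case False
  have "x \<in> range \<omega>"
    using assms mem_range_iff_shadow mem_shadow_iff by blast
  then show ?thesis
    using False by (simp add: confluence_def geodesic_path_step)
qed

text \<open>Outside the shadow of \<open>x\<close> the ray misses \<open>x\<close>, so the geodesics to \<open>x\<close> and to its parent
  have the same vertices on the ray.\<close>

lemma confluence_par:
  assumes "x \<noteq> x\<^sub>0" "\<omega> \<in> boundary adj x\<^sub>0" "\<omega> \<notin> shadow adj x\<^sub>0 x"
  shows "confluence adj x\<^sub>0 x \<omega> = confluence adj x\<^sub>0 (par x) \<omega>"
  using assms mem_range_iff_shadow by (simp add: confluence_def geodesic_path_step)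

end

section \<open>Martingales along the tree\<close>

context rooted_tree
begin

text \<open>The mass of the shadow of a vertex under the boundary measure.\<close>

definition mass :: "'v \<Rightarrow> real" where
  "mass x = (if x = x\<^sub>0 then 1 else real q / ((real q + 1) * real q ^ lev x))"

definition martingale :: "('v \<Rightarrow> complex) \<Rightarrow> bool" where
  "martingale m \<longleftrightarrow> (\<forall>x. (\<Sum>y\<in>children x. mass y *\<^sub>R m y) = mass x *\<^sub>R m x)"

definition energy :: "('v \<Rightarrow> complex) \<Rightarrow> nat \<Rightarrow> real" where
  "energy m n = (\<Sum>x\<in>level n. mass x * (cmod (m x))\<^sup>2)"

text \<open>The ancestor on level \<open>k\<close>; vertices nearer to the root are their own ancestors because
  subtraction is truncated.\<close>

definition anc :: "nat \<Rightarrow> 'v \<Rightarrow> 'v" where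
  "anc k x = (par ^^ (lev x - k)) x"

lemma mass_pos: "mass x > 0"
  using q_ge_2 by (simp add: mass_def)

lemma mass_nonneg [simp]: "mass x \<ge> 0"
  using mass_pos[of x] by simp

lemma mass_root [simp]: "mass x\<^sub>0 = 1"
  by (simp add: mass_def)

lemma mass_not_root: "x \<noteq> x\<^sub>0 \<Longrightarrow> mass x * real q ^ lev x = real q / (real q + 1)"
  using q_ge_2 by (simp add: mass_def)

text \<open>Up to a factor 2 the masses on level \<open>n\<close> are \<open>q\<^sup>-\<^sup>n\<close>, so counting vertices with weight \<open>q\<^sup>-\<^sup>n\<close> amounts to
  measuring boundary sets.\<close>

lemma mass_power_bounds: "mass x * real q ^ lev x \<le> 1" "1 \<le> 2 * (mass x * real q ^ lev x)"
proof -
  have "mass x * real q ^ lev x \<le> 1 \<and> 1 \<le> 2 * (mass x * real q ^ lev x)"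
    by (cases "x = x\<^sub>0") (use q_ge_2 in \<open>simp_all add: mass_not_root field_simps\<close>)
  then show "mass x * real q ^ lev x \<le> 1" "1 \<le> 2 * (mass x * real q ^ lev x)"
    by auto
qed

lemma mass_child:
  assumes "y \<in> children x"
  shows "mass y = mass x / card (children x)"
proof -
  have y: "y \<noteq> x\<^sub>0" "lev y = Suc (lev x)"
    using children_imp[OF assms] by auto
  show ?thesis
    using q_ge_2 y
    by (cases "x = x\<^sub>0") (auto simp: mass_def card_children card_children_root field_simps add_nonneg_eq_0_iff)
qed

lemma card_children_pos: "card (children x) > 0"
  using q_ge_2 by (cases "x = x\<^sub>0") (simp_all add: card_children card_children_root)

lemma sum_mass_children: "(\<Sum>y\<in>children x. mass y) = mass x"
  using card_children_pos[of x] by (cases "children x = {}") (simp_all add: mass_child)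

lemma sum_mass_level_par:
  fixes f :: "'v \<Rightarrow> real"
  shows "(\<Sum>x\<in>level (Suc n). mass x * f (par x)) = (\<Sum>x\<in>level n. mass x * f x)"
proof -
  have "(\<Sum>y\<in>children x. mass y * f (par y)) = mass x * f x" for x
    using sum_mass_children[of x] children_imp(2)[of _ x]
    by (simp add: sum_distrib_right[symmetric])
  then show ?thesis
    by (simp add: sum_level_Suc)
qed

lemma sum_mass_level: "(\<Sum>x\<in>level n. mass x) = 1"
proof (induction n)
  case (Suc n)
  then show ?case
    using sum_mass_level_par[of "\<lambda>_. 1" n] by simp
qed (simp add: level_0)

lemma card_level_le: "real (card (level n)) \<le> 2 * real q ^ n"
proof -
  have "real (card (level n)) = (\<Sum>x\<in>level n. 1)"
    by simp
  also have "\<dots> \<le> (\<Sum>x\<in>level n. 2 * (mass x * real q ^ n))"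
    using mass_power_bounds(2) by (intro sum_mono) (auto simp: level_def)
  also have "\<dots> = 2 * (\<Sum>x\<in>level n. mass x) * real q ^ n"
    by (simp add: sum_distrib_left sum_distrib_right mult_ac)
  finally show ?thesis
    by (simp add: sum_mass_level)
qed

lemma martingaleD: "martingale m \<Longrightarrow> (\<Sum>y\<in>children x. mass y *\<^sub>R m y) = mass x *\<^sub>R m x"
  by (simp add: martingale_def)

lemma energy_nonneg: "energy m n \<ge> 0"
  by (simp add: energy_def sum_nonneg)

text \<open>The conditional variance identity: the cross term vanishes because \<open>m x\<close> is the mean of \<open>m\<close>
  over the children.\<close>

lemma martingale_variance:
  assumes "martingale m"
  shows "(\<Sum>y\<in>children x. mass y * (cmod (m y - c))\<^sup>2) =
         mass x * (cmod (m x - c))\<^sup>2 + (\<Sum>y\<in>children x. mass y * (cmod (m y - m x))\<^sup>2)"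
proof -
  have split: "(cmod (m y - c))\<^sup>2 = (cmod (m x - c))\<^sup>2 + (cmod (m y - m x))\<^sup>2 + 2 * ((m y - m x) \<bullet> (m x - c))" for y
    unfolding power2_norm_eq_inner by (simp add: inner_simps inner_commute)
  have "(\<Sum>y\<in>children x. mass y * (cmod (m y - c))\<^sup>2) =
      (\<Sum>y\<in>children x. mass y * (cmod (m x - c))\<^sup>2 + mass y * (cmod (m y - m x))\<^sup>2
         + 2 * (mass y *\<^sub>R (m y - m x) \<bullet> (m x - c)))"
    by (intro sum.cong refl, subst split) (simp add: distrib_left)
  also have "\<dots> = (\<Sum>y\<in>children x. mass y) * (cmod (m x - c))\<^sup>2
      + (\<Sum>y\<in>children x. mass y * (cmod (m y - m x))\<^sup>2)
      + 2 * ((\<Sum>y\<in>children x. mass y *\<^sub>R (m y - m x)) \<bullet> (m x - c))"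
    by (simp add: sum.distrib sum_distrib_left sum_distrib_right inner_sum_left)
  also have "(\<Sum>y\<in>children x. mass y *\<^sub>R (m y - m x)) = 0"
    using martingaleD[OF assms, of x] sum_mass_children[of x]
    by (simp add: scaleR_diff_right sum_subtractf scaleR_sum_left[symmetric])
  finally show ?thesis
    by (simp add: sum_mass_children)
qed

text \<open>A function \<open>g\<close> that does not change from parent to child is known one level earlier; taking \<open>g = 0\<close> gives the growth of the
  energy and taking \<open>g\<close> to be the value at an ancestor gives the distance between two levels.\<close>

lemma martingale_distance_Suc:
  assumes "martingale m" "\<And>y. y \<in> level (Suc n) \<Longrightarrow> g y = g (par y)"
  shows "(\<Sum>y\<in>level (Suc n). mass y * (cmod (m y - g y))\<^sup>2) =
         (\<Sum>x\<in>level n. mass x * (cmod (m x - g x))\<^sup>2)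
         + (\<Sum>y\<in>level (Suc n). mass y * (cmod (m y - m (par y)))\<^sup>2)"
proof -
  have "(\<Sum>y\<in>children x. mass y * (cmod (m y - g y))\<^sup>2) =
        mass x * (cmod (m x - g x))\<^sup>2 + (\<Sum>y\<in>children x. mass y * (cmod (m y - m (par y)))\<^sup>2)"
    if "x \<in> level n" for x
  proof -
    have "g y = g x" if y: "y \<in> children x" for y
      using assms(2)[of y] children_imp[OF y] \<open>x \<in> level n\<close> by (simp add: level_def)
    then show ?thesis
      using martingale_variance[OF assms(1), where x = x and c = "g x"] children_imp(2)[of _ x] by simp
  qed
  then show ?thesis
    by (simp add: sum_level_Suc sum.distrib)
qed

lemma energy_Suc:
  assumes "martingale m"
  shows "energy m (Suc n) = energy m n + (\<Sum>y\<in>level (Suc n). mass y * (cmod (m y - m (par y)))\<^sup>2)"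
  using martingale_distance_Suc[OF assms, of n "\<lambda>_. 0"] by (simp add: energy_def)

lemma energy_mono:
  assumes "martingale m" "n \<le> k"
  shows "energy m n \<le> energy m k"
  using assms(2)
  by (induction rule: dec_induct) (auto simp: energy_Suc[OF assms(1)] sum_nonneg intro: add_increasing2)

lemma anc_step:
  assumes "lev y = Suc n" "k \<le> n"
  shows "anc k y = anc k (par y)"
proof -
  have y: "y \<noteq> x\<^sub>0"
    using assms by auto
  have "lev (par y) = n" "lev y - k = Suc (n - k)"
    using lev_par[OF y] assms by auto
  then show ?thesis
    by (simp add: anc_def funpow_swap1)
qed

lemma martingale_distance_anc:
  assumes "martingale m" "k \<le> n"
  shows "(\<Sum>x\<in>level n. mass x * (cmod (m x - m (anc k x)))\<^sup>2) = energy m n - energy m k"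
  using assms(2)
proof (induction rule: dec_induct)
  case base
  then show ?case by (simp add: anc_def level_def)
next
  case (step n)
  have "m (anc k y) = m (anc k (par y))" if "y \<in> level (Suc n)" for y
    using that step.hyps by (simp add: anc_step level_def)
  then show ?case
    using martingale_distance_Suc[OF assms(1), of n "\<lambda>x. m (anc k x)"] step.IH
    by (simp add: energy_Suc[OF assms(1)])
qed

end

section \<open>The weak type bound for martingales\<close>

text \<open>The terms that are not cut off form a geometric sum dominated by four times its last term; the
  minimum with \<open>a ^ N\<close> strengthens the claim so that it survives induction.\<close>

lemma sum_geometric_below_le:
  fixes a L :: real
  assumes "a \<ge> 4 / 3" "L \<ge> 0"
  shows "(\<Sum>n\<le>N. if a ^ n < L then a ^ n else 0) \<le> 4 * min L (a ^ N)"
proof (induction N)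
  case 0
  then show ?case using assms by (simp add: min_def)
next
  case (Suc N)
  have "a ^ Suc N \<ge> 4 / 3 * a ^ N"
    using assms by (simp add: mult_right_mono)
  moreover have "a ^ N \<ge> 0"
    using assms by simp
  ultimately show ?case
    using Suc by (auto simp: min_def split: if_splits)
qed

context rooted_tree
begin

text \<open>The map \<open>c \<mapsto> max (\<bar>c\<bar> - s) 0\<close> is convex, so it turns a martingale into a submartingale.\<close>

lemma martingale_truncation_mono:
  assumes m: "martingale m" and "n \<le> k"
  shows "(\<Sum>x\<in>level n. mass x * max (cmod (m x) - s) 0) \<le> (\<Sum>x\<in>level k. mass x * max (cmod (m x) - s) 0)"
  using assms(2)
proof (induction rule: dec_induct)
  case (step k)
  have "mass x * max (cmod (m x) - s) 0 \<le> (\<Sum>y\<in>children x. mass y * max (cmod (m y) - s) 0)" for x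
  proof -
    have "mass x * cmod (m x) = norm (\<Sum>y\<in>children x. mass y *\<^sub>R m y)"
      using martingaleD[OF m, of x] by simp
    also have "\<dots> \<le> (\<Sum>y\<in>children x. mass y * cmod (m y))"
      by (rule order.trans[OF norm_sum]) simp
    finally have "mass x * (cmod (m x) - s) \<le> (\<Sum>y\<in>children x. mass y * (cmod (m y) - s))"
      using sum_mass_children[of x]
      by (simp add: right_diff_distrib sum_subtractf sum_distrib_right[symmetric])
    also have "\<dots> \<le> (\<Sum>y\<in>children x. mass y * max (cmod (m y) - s) 0)"
      by (intro sum_mono mult_left_mono) auto
    finally have "mass x * (cmod (m x) - s) \<le> (\<Sum>y\<in>children x. mass y * max (cmod (m y) - s) 0)" .
    moreover have "0 \<le> (\<Sum>y\<in>children x. mass y * max (cmod (m y) - s) 0)"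
      by (intro sum_nonneg) simp
    ultimately show ?thesis
      by (simp add: max_def)
  qed
  then have "(\<Sum>x\<in>level k. mass x * max (cmod (m x) - s) 0) \<le> (\<Sum>x\<in>level (Suc k). mass x * max (cmod (m x) - s) 0)"
    unfolding sum_level_Suc by (rule sum_mono)
  with step.IH show ?case
    by linarith
qed simp

text \<open>With \<open>a = sqrt q\<close>, a vertex on level \<open>n\<close> at which \<open>\<bar>m\<bar> > t a\<^sup>n\<close> contributes at least \<open>t a\<^sup>n / 2\<close> to the truncation
  of \<open>\<bar>m\<bar>\<close> at height \<open>t a\<^sup>n / 2\<close>. Moving all truncations to level \<open>N\<close> leaves, at each vertex \<open>y\<close> there, at most the terms
  \<open>a\<^sup>n \<bar>m y\<bar>\<close> with \<open>a\<^sup>n < 2 \<bar>m y\<bar> / t\<close>, whose sum is at most a multiple of \<open>\<bar>m y\<bar>\<^sup>2 / t\<close>.\<close>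

lemma exceedance_finite_bound:
  assumes m: "martingale m" and B: "energy m N \<le> B" and t: "t > 0"
  shows "t\<^sup>2 * card {x. lev x \<le> N \<and> t * sqrt q ^ lev x < cmod (m x)} \<le> 32 * B"
proof -
  define a where "a = sqrt q"
  have a: "a \<ge> 4 / 3" "a\<^sup>2 = q"
    unfolding a_def by (rule real_le_rsqrt) (use q_ge_2 in \<open>simp_all add: power2_eq_square\<close>)
  define g where "g n c = max (cmod c - t * a ^ n / 2) 0" for n c
  define bad where "bad n = {x \<in> level n. t * a ^ n < cmod (m x)}" for n
  have card_bad: "real (card (bad n)) \<le> (4 / t) * (\<Sum>y\<in>level N. mass y * (a ^ n * g n (m y)))"
    if "n \<le> N" for n
  proof -
    have "real (card (bad n)) = (\<Sum>x\<in>bad n. 1)"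
      by simp
    also have "\<dots> \<le> (\<Sum>x\<in>bad n. (4 / t) * (mass x * (a ^ n * g n (m x))))"
    proof (rule sum_mono)
      fix x assume x: "x \<in> bad n"
      then have l: "lev x = n" and "t * a ^ n / 2 \<le> g n (m x)"
        by (auto simp: bad_def level_def g_def max_def field_simps)
      have q_pow: "real q ^ lev x = a ^ n * a ^ n"
        using a(2)[symmetric] l by (simp add: power_mult_distrib[symmetric] power2_eq_square)
      have "t * 1 \<le> t * (2 * (mass x * (a ^ n * a ^ n)))"
        using t mass_power_bounds(2)[of x] unfolding q_pow by (intro mult_left_mono) auto
      also have "\<dots> = 4 * (mass x * a ^ n) * (t * a ^ n / 2)"
        by simp
      also have "\<dots> \<le> 4 * (mass x * a ^ n) * g n (m x)"
        using a \<open>t * a ^ n / 2 \<le> g n (m x)\<close> by (intro mult_left_mono) simp_all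
      finally show "1 \<le> (4 / t) * (mass x * (a ^ n * g n (m x)))"
        using t by (simp add: field_simps)
    qed
    also have "\<dots> \<le> (\<Sum>x\<in>level n. (4 / t) * (mass x * (a ^ n * g n (m x))))"
      using a t by (intro sum_mono2) (auto simp: bad_def g_def)
    also have "\<dots> = (4 / t * a ^ n) * (\<Sum>x\<in>level n. mass x * g n (m x))"
      by (simp add: sum_distrib_left mult_ac)
    also have "\<dots> \<le> (4 / t * a ^ n) * (\<Sum>x\<in>level N. mass x * g n (m x))"
      unfolding g_def using a t by (intro mult_left_mono martingale_truncation_mono[OF m that]) auto
    also have "\<dots> = (4 / t) * (\<Sum>y\<in>level N. mass y * (a ^ n * g n (m y)))"
      by (simp add: sum_distrib_left mult_ac)
    finally show ?thesis .
  qed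
  have geometric: "(\<Sum>n\<le>N. a ^ n * g n c) \<le> 8 / t * (cmod c)\<^sup>2" for c
  proof -
    define L where "L = 2 * cmod c / t"
    have "a ^ n * g n c \<le> cmod c * (if a ^ n < L then a ^ n else 0)" for n
      using a t by (auto simp: g_def L_def max_def field_simps)
    then have "(\<Sum>n\<le>N. a ^ n * g n c) \<le> (\<Sum>n\<le>N. cmod c * (if a ^ n < L then a ^ n else 0))"
      by (rule sum_mono)
    also have "\<dots> = cmod c * (\<Sum>n\<le>N. if a ^ n < L then a ^ n else 0)"
      by (simp only: sum_distrib_left)
    also have "\<dots> \<le> cmod c * (4 * L)"
      using sum_geometric_below_le[OF a(1), of L N] t by (intro mult_left_mono) (auto simp: L_def)
    finally show ?thesis
      by (simp add: L_def power2_eq_square mult_ac)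
  qed
  have "{x. lev x \<le> N \<and> t * a ^ lev x < cmod (m x)} = (\<Union>n\<in>{..N}. bad n)"
    by (auto simp: bad_def level_def)
  then have "real (card {x. lev x \<le> N \<and> t * a ^ lev x < cmod (m x)}) \<le> (\<Sum>n\<le>N. real (card (bad n)))"
    using card_UN_le[of "{..N}" bad] by (simp flip: of_nat_sum)
  also have "\<dots> \<le> (\<Sum>n\<le>N. (4 / t) * (\<Sum>y\<in>level N. mass y * (a ^ n * g n (m y))))"
    using card_bad by (intro sum_mono) simp
  also have "\<dots> = (4 / t) * (\<Sum>y\<in>level N. mass y * (\<Sum>n\<le>N. a ^ n * g n (m y)))"
    unfolding sum_distrib_left[symmetric] by (subst sum.swap) (simp only: sum_distrib_left)
  also have "\<dots> \<le> (4 / t) * (\<Sum>y\<in>level N. mass y * (8 / t * (cmod (m y))\<^sup>2))"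
    using t geometric by (intro mult_left_mono sum_mono) auto
  also have "\<dots> = 32 / t\<^sup>2 * energy m N"
    by (simp add: energy_def sum_distrib_left power2_eq_square mult_ac)
  also have "\<dots> \<le> 32 / t\<^sup>2 * B"
    using B by (intro mult_left_mono) auto
  finally show ?thesis
    using t unfolding a_def by (simp add: field_simps)
qed

lemma finite_ball: "finite {x. lev x \<le> N}"
proof -
  have "{x. lev x \<le> N} = (\<Union>n\<in>{..N}. level n)"
    by (auto simp: level_def)
  then show ?thesis
    by simp
qed

text \<open>Every finite subset lies in a ball, where \<open>exceedance_finite_bound\<close> applies with a constant
  independent of the radius.\<close>

lemma weak_type_martingale:
  assumes m: "martingale m" and B: "\<And>n. energy m n \<le> B" and t: "t > 0"
  shows "finite {x. t * sqrt q ^ lev x < cmod (m x)}"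
    and "t\<^sup>2 * card {x. t * sqrt q ^ lev x < cmod (m x)} \<le> 32 * B"
proof -
  let ?S = "{x. t * sqrt q ^ lev x < cmod (m x)}"
  have sub: "t\<^sup>2 * card X \<le> 32 * B" if X: "X \<subseteq> ?S" "finite X" for X
  proof -
    obtain N where N: "\<And>x. x \<in> X \<Longrightarrow> lev x \<le> N"
      using finite_nat_set_iff_bounded_le[of "lev ` X"] X(2) by auto
    have "card X \<le> card {x. lev x \<le> N \<and> t * sqrt q ^ lev x < cmod (m x)}"
      using X(1) N by (intro card_mono finite_subset[OF _ finite_ball[of N]]) auto
    then have "t\<^sup>2 * card X \<le> t\<^sup>2 * card {x. lev x \<le> N \<and> t * sqrt q ^ lev x < cmod (m x)}"
      by (intro mult_left_mono) auto
    also have "\<dots> \<le> 32 * B"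
      by (rule exceedance_finite_bound[OF m B t])
    finally show ?thesis .
  qed
  show fin: "finite ?S"
  proof (rule ccontr)
    assume "infinite ?S"
    obtain k :: nat where k: "32 * B / t\<^sup>2 < k"
      using reals_Archimedean2 by blast
    obtain X where "finite X" "card X = k" "X \<subseteq> ?S"
      using infinite_arbitrarily_large[OF \<open>infinite ?S\<close>] by blast
    then show False
      using sub[of X] k t by (simp add: field_simps)
  qed
  show "t\<^sup>2 * card ?S \<le> 32 * B"
    by (rule sub[OF order_refl fin])
qed

end

section \<open>Limits in L2 of a probability space\<close>

lemma L2_measurable: "F \<in> L2 M \<Longrightarrow> F \<in> borel_measurable M"
  by (simp add: L2_def)

lemma L2_integrable_square: "F \<in> L2 M \<Longrightarrow> integrable M (\<lambda>\<omega>. (cmod (F \<omega>))\<^sup>2)"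
  by (simp add: L2_def)

lemma (in finite_measure) L2_integrable:
  assumes "F \<in> L2 M"
  shows "integrable M F"
proof -
  have [measurable]: "F \<in> borel_measurable M"
    by (rule L2_measurable[OF assms])
  have "integrable M (\<lambda>\<omega>. cmod (F \<omega>))"
    using L2_integrable_square[OF assms] by (rule square_integrable_imp_integrable[rotated]) simp
  then show ?thesis
    by (rule integrable_norm_cancel) simp
qed

text \<open>The quadratic form \<open>\<integral>\<^sub>A (s \<bar>F\<bar> - t)\<^sup>2\<close> in \<open>(s, t)\<close> is nonnegative.\<close>

lemma (in finite_measure) set_integral_Cauchy_Schwarz:
  assumes F: "F \<in> L2 M" and A: "A \<in> sets M"
  shows "(cmod (LINT \<omega>:A|M. F \<omega>))\<^sup>2 \<le> measure M A * (LINT \<omega>:A|M. (cmod (F \<omega>))\<^sup>2)"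
proof -
  note [measurable] = L2_measurable[OF F] A
  define c where "c = (LINT \<omega>:A|M. cmod (F \<omega>))"
  define e where "e = (LINT \<omega>:A|M. (cmod (F \<omega>))\<^sup>2)"
  define a where "a = measure M A"
  have iF: "set_integrable M A F"
    using L2_integrable[OF F] A unfolding set_integrable_def by (intro integrable_mult_indicator)
  have i1: "set_integrable M A (\<lambda>\<omega>. cmod (F \<omega>))"
    using integrable_norm[OF L2_integrable[OF F]] A
    unfolding set_integrable_def by (intro integrable_mult_indicator)
  have i2: "set_integrable M A (\<lambda>\<omega>. (cmod (F \<omega>))\<^sup>2)"
    using L2_integrable_square[OF F] A unfolding set_integrable_def by (intro integrable_mult_indicator)
  have i0: "set_integrable M A (\<lambda>_. k)" for k :: real
    using A unfolding set_integrable_def by (intro integrable_mult_indicator) auto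
  have k: "(LINT \<omega>:A|M. k) = a * k" for k :: real
    using A by (simp add: set_lebesgue_integral_def a_def)
  have "cmod (LINT \<omega>:A|M. F \<omega>) \<le> c"
    unfolding c_def by (rule set_integral_norm_bound[OF iF])
  then have le: "(cmod (LINT \<omega>:A|M. F \<omega>))\<^sup>2 \<le> c\<^sup>2"
    by (intro power_mono) auto
  have square: "0 \<le> s\<^sup>2 * e - 2 * s * t * c + a * t\<^sup>2" for s t
  proof -
    have "0 \<le> (LINT \<omega>:A|M. (s * cmod (F \<omega>) - t)\<^sup>2)"
      unfolding set_lebesgue_integral_def by (intro Bochner_Integration.integral_nonneg) simp
    also have "\<dots> = (LINT \<omega>:A|M. s\<^sup>2 * (cmod (F \<omega>))\<^sup>2 - (2 * s * t) * cmod (F \<omega>) + t\<^sup>2)"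
      by (intro arg_cong[where f = "set_lebesgue_integral M A"] ext)
         (simp add: power2_eq_square algebra_simps)
    also have "\<dots> = s\<^sup>2 * e - (2 * s * t) * c + a * t\<^sup>2"
      using i0 i1 i2 by (simp add: e_def c_def k set_integral_add set_integral_diff)
    finally show ?thesis
      by simp
  qed
  have "c\<^sup>2 \<le> a * e"
  proof (cases "a = 0")
    case True
    have "c = 0"
    proof (rule ccontr)
      assume "c \<noteq> 0"
      then show False
        \<comment> \<open>for \<open>s = 1\<close> the form is linear in \<open>t\<close> with slope \<open>- 2 c\<close>, hence takes the value \<open>-1\<close>\<close>
        using square[of 1 "(e + 1) / (2 * c)"] True by simp
    qed
    then show ?thesis
      using True by simp
  next
    case False
    then have "a > 0"
      by (simp add: a_def zero_less_measure_iff)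
    have "a * (a * e - c\<^sup>2) \<ge> 0"
      using square[of a c] by (simp add: power2_eq_square algebra_simps)
    then show ?thesis
      using \<open>a > 0\<close> by (simp add: zero_le_mult_iff)
  qed
  with le show ?thesis
    by (simp add: a_def e_def)
qed

lemma (in prob_space) L1_le_L2:
  assumes F: "F \<in> L2 M"
  shows "expectation (\<lambda>\<omega>. cmod (F \<omega>)) \<le> sqrt (expectation (\<lambda>\<omega>. (cmod (F \<omega>))\<^sup>2))"
proof -
  note [measurable] = L2_measurable[OF F]
  have "(\<lambda>\<omega>. of_real (cmod (F \<omega>))) \<in> L2 M"
    using L2_integrable_square[OF F] by (simp add: L2_def)
  then have "(cmod (LINT \<omega>:space M|M. of_real (cmod (F \<omega>))))\<^sup>2
      \<le> measure M (space M) * (LINT \<omega>:space M|M. (cmod (of_real (cmod (F \<omega>))))\<^sup>2)"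
    by (rule set_integral_Cauchy_Schwarz) simp
  then have "(expectation (\<lambda>\<omega>. cmod (F \<omega>)))\<^sup>2 \<le> expectation (\<lambda>\<omega>. (cmod (F \<omega>))\<^sup>2)"
    by (simp add: set_integral_space integral_complex_of_real L2_integrable[OF F]
        integrable_norm L2_integrable_square[OF F] prob_space)
  then show ?thesis
    by (rule real_le_rsqrt)
qed

text \<open>The increments have \<open>L\<^sup>1\<close> norms at most \<open>2\<^sup>-\<^sup>n\<close>, so their series converges absolutely almost
  everywhere and in \<open>L\<^sup>1\<close>, which gives the integrals over measurable sets; Fatou's lemma gives
  square integrability of the sum.\<close>

lemma (in prob_space) L2_limit:
  fixes G :: "nat \<Rightarrow> 'a \<Rightarrow> complex"
  assumes G: "\<And>n. G n \<in> L2 M"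
    and step: "\<And>n. (\<lambda>\<omega>. G (Suc n) \<omega> - G n \<omega>) \<in> L2 M"
    and small: "\<And>n. expectation (\<lambda>\<omega>. (cmod (G (Suc n) \<omega> - G n \<omega>))\<^sup>2) \<le> (1 / 4) ^ n"
    and bound: "\<And>n. expectation (\<lambda>\<omega>. (cmod (G n \<omega>))\<^sup>2) \<le> B"
  shows "\<exists>F \<in> L2 M. \<forall>A \<in> sets M. (\<lambda>n. LINT \<omega>:A|M. G n \<omega>) \<longlonglongrightarrow> (LINT \<omega>:A|M. F \<omega>)"
proof -
  define f where "f = (\<lambda>n \<omega>. G (Suc n) \<omega> - G n \<omega>)"
  have Gm [measurable]: "G n \<in> borel_measurable M" for n
    by (rule L2_measurable[OF G])
  have fm [measurable]: "f n \<in> borel_measurable M" for n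
    unfolding f_def by measurable
  have fi: "integrable M (f n)" for n
    using L2_integrable[OF step[of n]] by (simp add: f_def)
  have Gi: "integrable M (G n)" for n
    by (rule L2_integrable[OF G])
  have partial: "(\<Sum>i<n. f i \<omega>) = G n \<omega> - G 0 \<omega>" for n \<omega>
    unfolding f_def by (rule sum_lessThan_telescope)
  have L1: "expectation (\<lambda>\<omega>. cmod (f n \<omega>)) \<le> (1 / 2) ^ n" for n
  proof -
    have "expectation (\<lambda>\<omega>. cmod (f n \<omega>)) \<le> sqrt ((1 / 4) ^ n)"
      using L1_le_L2[OF step[of n]] small[of n] unfolding f_def
      by (meson order.trans real_sqrt_le_mono)
    also have "sqrt ((1 / 4) ^ n) = (1 / 2) ^ n"
      by (simp add: real_sqrt_power real_sqrt_divide)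
    finally show ?thesis .
  qed
  have summable_L1: "summable (\<lambda>n. expectation (\<lambda>\<omega>. cmod (f n \<omega>)))"
    by (rule summable_comparison_test'[of "\<lambda>n. (1 / 2) ^ n" 0]) (use L1 in \<open>auto simp: integral_nonneg\<close>)
  have AE_summable: "AE \<omega> in M. summable (\<lambda>n. cmod (f n \<omega>))"
  proof -
    have "(\<integral>\<^sup>+ \<omega>. (\<Sum>n. ennreal (cmod (f n \<omega>))) \<partial>M) = (\<Sum>n. \<integral>\<^sup>+ \<omega>. ennreal (cmod (f n \<omega>)) \<partial>M)"
      by (rule nn_integral_suminf) measurable
    also have "\<dots> = (\<Sum>n. ennreal (expectation (\<lambda>\<omega>. cmod (f n \<omega>))))"
      using fi by (intro suminf_cong nn_integral_eq_integral integrable_norm) auto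
    also have "\<dots> \<noteq> \<infinity>"
      using summable_L1 by (simp add: ennreal_suminf_neq_top integral_nonneg)
    finally have "AE \<omega> in M. (\<Sum>n. ennreal (cmod (f n \<omega>))) \<noteq> \<infinity>"
      by (intro nn_integral_noteq_infinite) measurable
    then show ?thesis
      by eventually_elim (rule summable_suminf_not_top, auto)
  qed
  define F where "F = (\<lambda>\<omega>. G 0 \<omega> + (\<Sum>n. f n \<omega>))"
  have Si: "integrable M (\<lambda>\<omega>. \<Sum>n. f n \<omega>)"
    by (rule integrable_suminf[OF fi AE_summable summable_L1])
  have Fi: "integrable M F"
    unfolding F_def using Gi Si by simp
  note [measurable] = borel_measurable_integrable[OF Fi]
  have AE_lim: "AE \<omega> in M. (\<lambda>n. G n \<omega>) \<longlonglongrightarrow> F \<omega>"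
    using AE_summable
  proof eventually_elim
    case (elim \<omega>)
    then have "(\<lambda>n. \<Sum>i<n. f i \<omega>) \<longlonglongrightarrow> (\<Sum>i. f i \<omega>)"
      by (rule summable_LIMSEQ[OF summable_norm_cancel])
    then have "(\<lambda>n. G 0 \<omega> + (\<Sum>i<n. f i \<omega>)) \<longlonglongrightarrow> F \<omega>"
      unfolding F_def by (intro tendsto_add tendsto_const)
    then show ?case
      by (simp add: partial)
  qed
  have "(\<integral>\<^sup>+ \<omega>. ennreal ((cmod (F \<omega>))\<^sup>2) \<partial>M) = (\<integral>\<^sup>+ \<omega>. liminf (\<lambda>n. ennreal ((cmod (G n \<omega>))\<^sup>2)) \<partial>M)"
  proof (rule nn_integral_cong_AE, use AE_lim in eventually_elim)
    case (elim \<omega>)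
    then have "(\<lambda>n. ennreal ((cmod (G n \<omega>))\<^sup>2)) \<longlonglongrightarrow> ennreal ((cmod (F \<omega>))\<^sup>2)"
      by (intro tendsto_intros)
    then show ?case
      by (intro lim_imp_Liminf[symmetric]) simp
  qed
  also have "\<dots> \<le> liminf (\<lambda>n. \<integral>\<^sup>+ \<omega>. ennreal ((cmod (G n \<omega>))\<^sup>2) \<partial>M)"
    by (rule nn_integral_liminf) measurable
  also have "\<dots> \<le> liminf (\<lambda>n. ennreal B)"
    using L2_integrable_square[OF G] bound
    by (intro Liminf_mono always_eventually allI) (simp add: nn_integral_eq_integral ennreal_leI)
  also have "\<dots> < \<infinity>"
    by (simp add: Liminf_const)
  finally have "F \<in> L2 M"
    unfolding L2_def by (auto intro!: integrableI_bounded)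
  moreover have "(\<lambda>n. LINT \<omega>:A|M. G n \<omega>) \<longlonglongrightarrow> (LINT \<omega>:A|M. F \<omega>)" if A: "A \<in> sets M" for A
  proof -
    define g where "g = (\<lambda>n \<omega>. indicator A \<omega> *\<^sub>R f n \<omega>)"
    have gi: "integrable M (g n)" for n
      unfolding g_def by (rule integrable_mult_indicator[OF A fi])
    have le: "cmod (g n \<omega>) \<le> cmod (f n \<omega>)" for n \<omega>
      by (simp add: g_def indicator_def)
    have "(\<lambda>n. expectation (g n)) sums expectation (\<lambda>\<omega>. \<Sum>n. g n \<omega>)"
    proof (rule sums_integral[OF gi])
      show "AE \<omega> in M. summable (\<lambda>n. cmod (g n \<omega>))"
        using AE_summable
        by eventually_elim (rule summable_comparison_test', assumption, use le in auto)
      show "summable (\<lambda>n. expectation (\<lambda>\<omega>. cmod (g n \<omega>)))"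
        using gi fi le
        by (intro summable_comparison_test'[OF summable_L1, of 0])
           (auto simp: integral_nonneg intro!: integral_mono integrable_norm)
    qed
    also have "(\<lambda>\<omega>. \<Sum>n. g n \<omega>) = (\<lambda>\<omega>. indicator A \<omega> *\<^sub>R (\<Sum>n. f n \<omega>))"
      by (auto simp: g_def indicator_def)
    finally have "(\<lambda>n. \<Sum>i<n. expectation (g i)) \<longlonglongrightarrow> (LINT \<omega>:A|M. \<Sum>n. f n \<omega>)"
      by (simp add: sums_def set_lebesgue_integral_def)
    moreover have "(\<Sum>i<n. expectation (g i)) = (LINT \<omega>:A|M. G n \<omega>) - (LINT \<omega>:A|M. G 0 \<omega>)" for n
    proof -
      have "(\<Sum>i<n. expectation (g i)) = expectation (\<lambda>\<omega>. \<Sum>i<n. g i \<omega>)"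
        using gi by simp
      also have "\<dots> = (LINT \<omega>:A|M. G n \<omega> - G 0 \<omega>)"
        unfolding set_lebesgue_integral_def partial[symmetric] g_def by (simp add: scaleR_sum_right)
      also have "\<dots> = (LINT \<omega>:A|M. G n \<omega>) - (LINT \<omega>:A|M. G 0 \<omega>)"
        using Gi A by (intro set_integral_diff) (auto simp: set_integrable_def intro!: integrable_mult_indicator)
      finally show ?thesis .
    qed
    ultimately have "(\<lambda>n. (LINT \<omega>:A|M. G 0 \<omega>) + ((LINT \<omega>:A|M. G n \<omega>) - (LINT \<omega>:A|M. G 0 \<omega>)))
        \<longlonglongrightarrow> (LINT \<omega>:A|M. G 0 \<omega>) + (LINT \<omega>:A|M. \<Sum>n. f n \<omega>)"
      by (intro tendsto_add tendsto_const) simp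
    also have "(LINT \<omega>:A|M. G 0 \<omega>) + (LINT \<omega>:A|M. \<Sum>n. f n \<omega>) = (LINT \<omega>:A|M. F \<omega>)"
      unfolding F_def using Gi Si A
      by (intro set_integral_add(2)[symmetric]) (auto simp: set_integrable_def intro!: integrable_mult_indicator)
    finally show ?thesis
      by simp
  qed
  ultimately show ?thesis
    by blast
qed

section \<open>Martingales and functions on the boundary\<close>

locale tree_boundary = rooted_tree adj q x\<^sub>0
  for adj :: "'v \<Rightarrow> 'v \<Rightarrow> bool" and q :: nat and x\<^sub>0 :: 'v +
  fixes \<nu> :: "(nat \<Rightarrow> 'v) measure"
  assumes boundary_measure: "is_boundary_measure adj q x\<^sub>0 \<nu>"
begin

sublocale prob_space \<nu>
  using boundary_measure by (simp add: is_boundary_measure_def)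

lemma space_boundary: "space \<nu> = boundary adj x\<^sub>0"
  using boundary_measure by (simp add: is_boundary_measure_def)

lemma shadow_sets [measurable, simp]: "shadow adj x\<^sub>0 x \<in> sets \<nu>"
  using boundary_measure by (auto simp: is_boundary_measure_def intro: sigma_sets.Basic)

lemma measure_shadow: "measure \<nu> (shadow adj x\<^sub>0 x) = mass x"
proof (cases "x = x\<^sub>0")
  case True
  then show ?thesis
    using prob_space by (simp add: shadow_root space_boundary[symmetric])
next
  case False
  then have "gdist adj x\<^sub>0 x \<ge> 1"
    using gdist_eq_0_iff[of x\<^sub>0 x] by (metis One_nat_def Suc_leI neq0_conv)
  then show ?thesis
    using False boundary_measure by (simp add: is_boundary_measure_def mass_def lev_def)
qed

definition shadow_avg :: "((nat \<Rightarrow> 'v) \<Rightarrow> complex) \<Rightarrow> 'v \<Rightarrow> complex" where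
  "shadow_avg F x = (1 / mass x) *\<^sub>R (LINT \<omega>:shadow adj x\<^sub>0 x|\<nu>. F \<omega>)"

lemma shadow_integral_eq: "(LINT \<omega>:shadow adj x\<^sub>0 x|\<nu>. F \<omega>) = mass x *\<^sub>R shadow_avg F x"
  using mass_pos[of x] by (simp add: shadow_avg_def)

lemma set_integrable_shadow:
  fixes F :: "(nat \<Rightarrow> 'v) \<Rightarrow> 'b::{banach, second_countable_topology}"
  shows "integrable \<nu> F \<Longrightarrow> set_integrable \<nu> (shadow adj x\<^sub>0 x) F"
  unfolding set_integrable_def by (intro integrable_mult_indicator) auto

lemma shadow_integral_children:
  fixes F :: "(nat \<Rightarrow> 'v) \<Rightarrow> 'b::{banach, second_countable_topology}"
  assumes "integrable \<nu> F"
  shows "(LINT \<omega>:shadow adj x\<^sub>0 x|\<nu>. F \<omega>) = (\<Sum>y\<in>children x. LINT \<omega>:shadow adj x\<^sub>0 y|\<nu>. F \<omega>)"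
  unfolding shadow_eq_Union_children[of x] using assms
  by (intro set_integral_finite_Union set_integrable_shadow)
     (auto simp: disjoint_family_on_def children_imp(3) intro!: disjoint_shadow)

lemma integral_eq_sum_level:
  fixes F :: "(nat \<Rightarrow> 'v) \<Rightarrow> 'b::{banach, second_countable_topology}"
  assumes "integrable \<nu> F"
  shows "(\<integral>\<omega>. F \<omega> \<partial>\<nu>) = (\<Sum>x\<in>level n. LINT \<omega>:shadow adj x\<^sub>0 x|\<nu>. F \<omega>)"
proof -
  have "(\<integral>\<omega>. F \<omega> \<partial>\<nu>) = (LINT \<omega>:(\<Union>x\<in>level n. shadow adj x\<^sub>0 x)|\<nu>. F \<omega>)"
    unfolding boundary_eq_Union_level[symmetric] space_boundary[symmetric]
    by (rule set_integral_space[OF assms, symmetric])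
  also have "\<dots> = (\<Sum>x\<in>level n. LINT \<omega>:shadow adj x\<^sub>0 x|\<nu>. F \<omega>)"
    using assms by (intro set_integral_finite_Union set_integrable_shadow)
      (auto simp: disjoint_family_on_def mem_shadow_iff, auto simp: level_def)
  finally show ?thesis .
qed

lemma martingale_shadow_avg:
  assumes "integrable \<nu> F"
  shows "martingale (shadow_avg F)"
  unfolding martingale_def shadow_integral_eq[symmetric]
  by (intro allI shadow_integral_children[OF assms, symmetric])

text \<open>Cauchy-Schwarz on each shadow of a level, summed over the partition of the boundary by that level.\<close>

lemma energy_shadow_avg_le:
  assumes F: "F \<in> L2 \<nu>"
  shows "energy (shadow_avg F) n \<le> (L2_norm \<nu> F)\<^sup>2"
proof -
  have "mass x * (cmod (shadow_avg F x))\<^sup>2 \<le> (LINT \<omega>:shadow adj x\<^sub>0 x|\<nu>. (cmod (F \<omega>))\<^sup>2)" for x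
  proof -
    have "(mass x * cmod (shadow_avg F x))\<^sup>2 \<le> mass x * (LINT \<omega>:shadow adj x\<^sub>0 x|\<nu>. (cmod (F \<omega>))\<^sup>2)"
      using set_integral_Cauchy_Schwarz[OF F shadow_sets, of x]
      by (simp add: shadow_integral_eq[of x F] measure_shadow)
    then have "mass x * (mass x * (cmod (shadow_avg F x))\<^sup>2) \<le> mass x * (LINT \<omega>:shadow adj x\<^sub>0 x|\<nu>. (cmod (F \<omega>))\<^sup>2)"
      by (simp add: power2_eq_square mult_ac)
    then show ?thesis
      using mass_pos[of x] by (simp only: mult_le_cancel_left_pos)
  qed
  then have "energy (shadow_avg F) n \<le> (\<integral>\<omega>. (cmod (F \<omega>))\<^sup>2 \<partial>\<nu>)"
    unfolding energy_def integral_eq_sum_level[OF L2_integrable_square[OF F], of n]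
    by (rule sum_mono)
  also have "\<dots> = (L2_norm \<nu> F)\<^sup>2"
    by (simp add: L2_norm_def)
  finally show ?thesis .
qed

lemma integral_indicator_shadow:
  fixes c :: "'b::{banach, second_countable_topology}"
  shows "(\<integral>\<omega>. indicator (shadow adj x\<^sub>0 x) \<omega> *\<^sub>R c \<partial>\<nu>) = mass x *\<^sub>R c"
  by (subst integral_scaleR_left) (auto simp: measure_shadow less_top[symmetric])

text \<open>A function of the \<open>n\<close>-th vertex of a ray is a step function on the shadows of level \<open>n\<close>; this
  makes it measurable and computes its integral.\<close>

lemma level_function_eq:
  fixes f :: "'v \<Rightarrow> 'b::real_vector"
  assumes "\<omega> \<in> space \<nu>"
  shows "f (\<omega> n) = (\<Sum>x\<in>level n. indicator (shadow adj x\<^sub>0 x) \<omega> *\<^sub>R f x)"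
proof -
  have w: "\<omega> \<in> boundary adj x\<^sub>0"
    using assms by (simp add: space_boundary)
  have "indicator (shadow adj x\<^sub>0 x) \<omega> *\<^sub>R f x = (if x = \<omega> n then f x else 0)" if "x \<in> level n" for x
    using that w by (auto simp: indicator_def mem_shadow_iff level_def)
  then show ?thesis
    using boundary_ray(2)[OF w] by (simp add: level_def[symmetric] sum.delta)
       (simp add: level_def boundary_ray(2)[OF w])
qed

lemma level_function_integral:
  fixes f :: "'v \<Rightarrow> 'b::{banach, second_countable_topology}"
  shows "integrable \<nu> (\<lambda>\<omega>. f (\<omega> n))"
    and "(\<integral>\<omega>. f (\<omega> n) \<partial>\<nu>) = (\<Sum>x\<in>level n. mass x *\<^sub>R f x)"
proof -
  have *: "integrable \<nu> (\<lambda>\<omega>. indicator (shadow adj x\<^sub>0 x) \<omega> *\<^sub>R f x)" for x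
    by (intro integrable_mult_indicator) auto
  then have "integrable \<nu> (\<lambda>\<omega>. \<Sum>x\<in>level n. indicator (shadow adj x\<^sub>0 x) \<omega> *\<^sub>R f x)"
    by (rule Bochner_Integration.integrable_sum)
  also have "?this \<longleftrightarrow> integrable \<nu> (\<lambda>\<omega>. f (\<omega> n))"
    by (intro Bochner_Integration.integrable_cong refl level_function_eq[symmetric])
  finally show "integrable \<nu> (\<lambda>\<omega>. f (\<omega> n))" .
  have "(\<integral>\<omega>. f (\<omega> n) \<partial>\<nu>) = (\<integral>\<omega>. (\<Sum>x\<in>level n. indicator (shadow adj x\<^sub>0 x) \<omega> *\<^sub>R f x) \<partial>\<nu>)"
    by (intro Bochner_Integration.integral_cong refl level_function_eq)
  also have "\<dots> = (\<Sum>x\<in>level n. mass x *\<^sub>R f x)"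
    using * by (simp only: Bochner_Integration.integral_sum integral_indicator_shadow)
  finally show "(\<integral>\<omega>. f (\<omega> n) \<partial>\<nu>) = (\<Sum>x\<in>level n. mass x *\<^sub>R f x)" .
qed

lemma level_function_L2: "(\<lambda>\<omega>. m (\<omega> n)) \<in> L2 \<nu>"
  unfolding L2_def
  using level_function_integral(1)[of m n] level_function_integral(1)[of "\<lambda>x. (cmod (m x))\<^sup>2" n]
  by auto

lemma shadow_integral_martingale:
  assumes m: "martingale m" and "lev x \<le> n"
  shows "(LINT \<omega>:shadow adj x\<^sub>0 x|\<nu>. m (\<omega> n)) = mass x *\<^sub>R m x"
proof -
  define k where "k = n - lev x"
  then have "lev x + k = n"
    using assms(2) by simp
  then show ?thesis
  proof (induction k arbitrary: x)
    case 0
    have "(LINT \<omega>:shadow adj x\<^sub>0 x|\<nu>. m (\<omega> n)) = (LINT \<omega>:shadow adj x\<^sub>0 x|\<nu>. m x)"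
      using 0 by (intro set_lebesgue_integral_cong) (auto simp: mem_shadow_iff)
    then show ?case
      by (simp only: set_lebesgue_integral_def integral_indicator_shadow)
  next
    case (Suc k)
    then have "(\<Sum>y\<in>children x. LINT \<omega>:shadow adj x\<^sub>0 y|\<nu>. m (\<omega> n)) = (\<Sum>y\<in>children x. mass y *\<^sub>R m y)"
      using children_imp(3)[of _ x] by (intro sum.cong) auto
    then show ?case
      using martingaleD[OF m, of x] shadow_integral_children[OF level_function_integral(1)[of m n], of x]
      by simp
  qed
qed

lemma anc_ray:
  assumes "\<omega> \<in> boundary adj x\<^sub>0" "k \<le> n"
  shows "anc k (\<omega> n) = \<omega> k"
proof -
  have "(par ^^ j) (\<omega> (k + j)) = \<omega> k" for j
    by (induction j) (simp_all add: boundary_ray(3)[OF assms(1)] funpow_Suc_right del: funpow.simps(2))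
  from this[of "n - k"] show ?thesis
    using assms by (simp add: anc_def boundary_ray(2))
qed

lemma integral_level_distance:
  assumes "martingale m" "k \<le> n"
  shows "(\<integral>\<omega>. (cmod (m (\<omega> n) - m (\<omega> k)))\<^sup>2 \<partial>\<nu>) = energy m n - energy m k"
proof -
  have "(\<integral>\<omega>. (cmod (m (\<omega> n) - m (\<omega> k)))\<^sup>2 \<partial>\<nu>) = (\<integral>\<omega>. (cmod (m (\<omega> n) - m (anc k (\<omega> n))))\<^sup>2 \<partial>\<nu>)"
    using anc_ray assms(2) by (intro Bochner_Integration.integral_cong) (auto simp: space_boundary)
  also have "\<dots> = energy m n - energy m k"
    using level_function_integral(2)[of "\<lambda>x. (cmod (m x - m (anc k x)))\<^sup>2" n]
      martingale_distance_anc[OF assms] by simp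
  finally show ?thesis .
qed

text \<open>The functions \<open>\<omega> \<mapsto> m (\<omega> n)\<close> have squared \<open>L\<^sup>2\<close> distances equal to differences of energies, and the
  energies converge. A subsequence is fast enough for \<open>L2_limit\<close>, and its integral over
  a fixed shadow is eventually constant.\<close>

lemma L2_bounded_martingale_closed:
  assumes m: "martingale m" and bound: "\<And>n. energy m n \<le> B"
  shows "\<exists>F \<in> L2 \<nu>. shadow_avg F = m"
proof -
  have "incseq (energy m)"
    using energy_mono[OF m] by (auto simp: incseq_def)
  then obtain E where E: "energy m \<longlonglongrightarrow> E" "\<And>n. energy m n \<le> E"
    using bound incseq_convergent[of "energy m" B] by auto
  have "\<exists>N. \<forall>n\<ge>N. E - energy m n \<le> (1 / 4) ^ i" for i
  proof -
    have "\<forall>\<^sub>F n in sequentially. energy m n > E - (1 / 4) ^ i"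
      using E(1) by (rule order_tendstoD) simp
    then have "\<forall>\<^sub>F n in sequentially. E - energy m n \<le> (1 / 4) ^ i"
      by eventually_elim linarith
    then show ?thesis
      unfolding eventually_sequentially .
  qed
  then obtain s0 where s0: "\<And>i n. n \<ge> s0 i \<Longrightarrow> E - energy m n \<le> (1 / 4) ^ i"
    by metis
  \<comment> \<open>a monotone index sequence above both \<open>s0\<close> and the identity\<close>
  define s where "s n = n + (\<Sum>i\<le>n. s0 i)" for n
  have s_ge: "s n \<ge> s0 n" "s n \<ge> n" "s n \<le> s (Suc n)" for n
    by (auto simp: s_def intro: trans_le_add2 member_le_sum)
  define G where "G = (\<lambda>n \<omega>. m (\<omega> (s n)))"
  have "\<exists>F \<in> L2 \<nu>. \<forall>A \<in> sets \<nu>. (\<lambda>n. LINT \<omega>:A|\<nu>. G n \<omega>) \<longlonglongrightarrow> (LINT \<omega>:A|\<nu>. F \<omega>)"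
  proof (rule L2_limit)
    show "G n \<in> L2 \<nu>" for n
      unfolding G_def by (rule level_function_L2)
    have eq: "m (anc (s n) (\<omega> (s (Suc n)))) = m (\<omega> (s n))" if "\<omega> \<in> space \<nu>" for \<omega> n
      using that anc_ray s_ge(3) by (simp add: space_boundary)
    have "(\<lambda>\<omega>. G (Suc n) \<omega> - G n \<omega>) \<in> L2 \<nu> \<longleftrightarrow>
        (\<lambda>\<omega>. m (\<omega> (s (Suc n))) - m (anc (s n) (\<omega> (s (Suc n))))) \<in> L2 \<nu>" for n
      unfolding L2_def G_def mem_Collect_eq
      by (intro conj_cong measurable_cong Bochner_Integration.integrable_cong) (simp_all add: eq)
    then show "(\<lambda>\<omega>. G (Suc n) \<omega> - G n \<omega>) \<in> L2 \<nu>" for n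
      using level_function_L2[of "\<lambda>x. m x - m (anc (s n) x)" "s (Suc n)"] by simp
    show "expectation (\<lambda>\<omega>. (cmod (G (Suc n) \<omega> - G n \<omega>))\<^sup>2) \<le> (1 / 4) ^ n" for n
      unfolding G_def integral_level_distance[OF m s_ge(3)]
      using E(2)[of "s (Suc n)"] s0[OF s_ge(1)[of n]] by linarith
    show "expectation (\<lambda>\<omega>. (cmod (G n \<omega>))\<^sup>2) \<le> B" for n
      unfolding G_def using bound[of "s n"] level_function_integral(2)[of "\<lambda>x. (cmod (m x))\<^sup>2" "s n"]
      by (simp add: energy_def)
  qed
  then obtain F where F: "F \<in> L2 \<nu>"
    "\<And>x. (\<lambda>n. LINT \<omega>:shadow adj x\<^sub>0 x|\<nu>. G n \<omega>) \<longlonglongrightarrow> (LINT \<omega>:shadow adj x\<^sub>0 x|\<nu>. F \<omega>)"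
    using shadow_sets by metis
  have "mass x *\<^sub>R shadow_avg F x = mass x *\<^sub>R m x" for x
  proof -
    have "\<forall>\<^sub>F n in sequentially. (LINT \<omega>:shadow adj x\<^sub>0 x|\<nu>. G n \<omega>) = mass x *\<^sub>R m x"
      using eventually_ge_at_top[of "lev x"]
      by eventually_elim (use shadow_integral_martingale[OF m] s_ge(2) in \<open>auto simp: G_def intro: order.trans\<close>)
    then have "(LINT \<omega>:shadow adj x\<^sub>0 x|\<nu>. F \<omega>) = mass x *\<^sub>R m x"
      by (rule LIMSEQ_unique[OF F(2)[of x] tendsto_eventually])
    then show ?thesis
      by (simp add: shadow_integral_eq)
  qed
  then have "shadow_avg F = m"
    using mass_pos by (metis ext order_less_irrefl scaleR_left_imp_eq)
  with F(1) show ?thesis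
    by blast
qed

end

section \<open>Weak L2 and sums over balls\<close>

text \<open>The condition \<open>weak_L2_norm u \<le> A\<close> freed from extended numbers and square roots.\<close>

definition weak_L2_bound :: "('v \<Rightarrow> complex) \<Rightarrow> real \<Rightarrow> bool" where
  "weak_L2_bound u A \<longleftrightarrow>
     (\<forall>t>0. finite {x. cmod (u x) > t} \<and> t\<^sup>2 * card {x. cmod (u x) > t} \<le> A\<^sup>2)"

lemma weak_L2_norm_le_iff:
  assumes "A \<ge> 0"
  shows "weak_L2_norm u \<le> ennreal A \<longleftrightarrow> weak_L2_bound u A"
proof -
  have step: "(if finite {x. cmod (u x) > t} then ennreal (t * sqrt (real (card {x. cmod (u x) > t}))) else \<infinity>)
          \<le> ennreal A \<longleftrightarrow> finite {x. cmod (u x) > t} \<and> t\<^sup>2 * card {x. cmod (u x) > t} \<le> A\<^sup>2"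
    if "t > 0" for t
  proof -
    let ?c = "real (card {x. cmod (u x) > t})"
    have "t * sqrt ?c \<le> A \<longleftrightarrow> (t * sqrt ?c)\<^sup>2 \<le> A\<^sup>2"
      using that assms by (simp add: power2_le_iff_abs_le)
    then show ?thesis
      using assms by (simp add: ennreal_le_iff power_mult_distrib top_unique)
  qed
  then show ?thesis
    unfolding weak_L2_norm_def weak_L2_bound_def
    by (simp only: SUP_le_iff Ball_def greaterThan_iff cong: imp_cong)
qed

lemma weak_L2_iff: "u \<in> weak_L2 \<longleftrightarrow> (\<exists>A>0. weak_L2_bound u A)"
proof
  assume "u \<in> weak_L2"
  then obtain B where B: "weak_L2_norm u = ennreal B" "B \<ge> 0"
    unfolding weak_L2_def by (cases "weak_L2_norm u" rule: ennreal_cases) auto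
  then have "weak_L2_norm u \<le> ennreal (B + 1)"
    by (simp add: ennreal_leI)
  then show "\<exists>A>0. weak_L2_bound u A"
    using B(2) weak_L2_norm_le_iff[of "B + 1" u] by (intro exI[of _ "B + 1"]) simp
next
  assume "\<exists>A>0. weak_L2_bound u A"
  then obtain A where "weak_L2_norm u \<le> ennreal A"
    using weak_L2_norm_le_iff[of _ u] by (meson less_imp_le)
  then show "u \<in> weak_L2"
    unfolding weak_L2_def by (simp add: le_less_trans[OF _ ennreal_less_top])
qed

text \<open>Layer-cake with the heights \<open>A\<^sup>2 / b\<^sup>j\<close>: at most \<open>b\<^sup>j\<^sup>+\<^sup>1\<close> points lie above the height
  \<open>A\<^sup>2 / b\<^sup>j\<^sup>+\<^sup>1\<close>, so each of the \<open>n\<close> layers contributes at most \<open>A\<^sup>2 b\<close>, and below the last height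
  every point of \<open>X\<close> is counted.\<close>

lemma sum_square_le_weak_L2_bound:
  fixes b :: real
  assumes u: "weak_L2_bound u A" and A: "A > 0" and X: "finite X" and b: "b > 1"
  shows "(\<Sum>x\<in>X. (cmod (u x))\<^sup>2) \<le> A\<^sup>2 * (b * n + card X / b ^ n)"
proof -
  have count: "real (card {x\<in>X. (cmod (u x))\<^sup>2 > A\<^sup>2 / s}) \<le> s" if "s > 0" for s
  proof -
    define t where "t = A / sqrt s"
    have t: "t > 0" "t\<^sup>2 = A\<^sup>2 / s"
      using A that by (simp_all add: t_def power_divide)
    have sub: "{x\<in>X. (cmod (u x))\<^sup>2 > A\<^sup>2 / s} \<subseteq> {x. cmod (u x) > t}"
      using t by (auto intro: power2_less_imp_less simp: t(2)[symmetric])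
    have bound: "finite {x. cmod (u x) > t}" "t\<^sup>2 * card {x. cmod (u x) > t} \<le> A\<^sup>2"
      using u t(1) by (auto simp: weak_L2_bound_def)
    have "A\<^sup>2 / s * card {x\<in>X. (cmod (u x))\<^sup>2 > A\<^sup>2 / s} \<le> A\<^sup>2 / s * card {x. cmod (u x) > t}"
      using that card_mono[OF bound(1) sub] by (intro mult_left_mono) auto
    also have "\<dots> \<le> A\<^sup>2"
      using bound(2) by (simp add: t(2))
    finally have "A\<^sup>2 * card {x\<in>X. (cmod (u x))\<^sup>2 > A\<^sup>2 / s} \<le> A\<^sup>2 * s"
      using that by (simp add: field_simps)
    then show ?thesis
      using A by simp
  qed
  have sup: "(cmod (u x))\<^sup>2 \<le> A\<^sup>2" for x
  proof (rule ccontr)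
    assume "\<not> (cmod (u x))\<^sup>2 \<le> A\<^sup>2"
    then have "A < cmod (u x)"
      using A by (meson power_mono not_le norm_ge_zero)
    then obtain t where t: "A < t" "t < cmod (u x)"
      using dense by blast
    then have bound: "finite {x. cmod (u x) > t}" "t\<^sup>2 * card {x. cmod (u x) > t} \<le> A\<^sup>2"
      using u A by (auto simp: weak_L2_bound_def)
    have "card {x. cmod (u x) > t} \<noteq> 0"
      using bound(1) t(2) by auto
    then have "t\<^sup>2 * 1 \<le> t\<^sup>2 * card {x. cmod (u x) > t}"
      by (intro mult_left_mono) auto
    moreover have "A\<^sup>2 < t\<^sup>2"
      using A t(1) by (simp add: power_strict_mono)
    ultimately show False
      using bound(2) by linarith
  qed
  have "(\<Sum>x\<in>X. (cmod (u x))\<^sup>2) \<le> A\<^sup>2 * (b * n) + (\<Sum>x\<in>X. min ((cmod (u x))\<^sup>2) (A\<^sup>2 / b ^ n))"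
  proof (induction n)
    case 0
    then show ?case
      using sup by (simp add: min_def)
  next
    case (Suc n)
    let ?Y = "{x\<in>X. (cmod (u x))\<^sup>2 > A\<^sup>2 / b ^ Suc n}"
    have "(\<Sum>x\<in>X. min ((cmod (u x))\<^sup>2) (A\<^sup>2 / b ^ n))
        \<le> (\<Sum>x\<in>X. min ((cmod (u x))\<^sup>2) (A\<^sup>2 / b ^ Suc n)
              + (if (cmod (u x))\<^sup>2 > A\<^sup>2 / b ^ Suc n then A\<^sup>2 / b ^ n else 0))"
      using b by (intro sum_mono) (auto simp: min_def intro: add_increasing)
    also have "\<dots> = (\<Sum>x\<in>X. min ((cmod (u x))\<^sup>2) (A\<^sup>2 / b ^ Suc n)) + card ?Y * (A\<^sup>2 / b ^ n)"
      by (simp add: sum.distrib sum.If_cases[OF X] Int_def)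
    also have "real (card ?Y) * (A\<^sup>2 / b ^ n) \<le> b ^ Suc n * (A\<^sup>2 / b ^ n)"
      using b by (intro mult_right_mono count) auto
    also have "b ^ Suc n * (A\<^sup>2 / b ^ n) = A\<^sup>2 * b"
      using b by simp
    finally show ?case
      using Suc by (simp add: algebra_simps)
  qed
  also have "(\<Sum>x\<in>X. min ((cmod (u x))\<^sup>2) (A\<^sup>2 / b ^ n)) \<le> (\<Sum>x\<in>X. A\<^sup>2 / b ^ n)"
    by (intro sum_mono) simp
  finally show ?thesis
    by (simp add: algebra_simps)
qed

context rooted_tree
begin

text \<open>The layer-cake estimate with \<open>b = q\<close> and \<open>n = N\<close>: the ball of radius \<open>N\<close> has at most \<open>4 q\<^sup>N\<close> points,
  so the points below the last height contribute only a constant, and the growth in \<open>N\<close> is linear.\<close>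

lemma sum_levels_le_weak_L2_bound:
  assumes u: "weak_L2_bound u A" and A: "A > 0"
  shows "(\<Sum>n\<le>N. \<Sum>x\<in>level n. (cmod (u x))\<^sup>2) \<le> A\<^sup>2 * (real q * real N + 4)"
proof -
  have disj: "i \<noteq> j \<Longrightarrow> level i \<inter> level j = {}" for i j
    by (auto simp: level_def)
  have geo: "(\<Sum>n\<le>N. real q ^ n) \<le> 2 * real q ^ N"
  proof (induction N)
    case (Suc N)
    have "2 * real q ^ N \<le> real q * real q ^ N"
      using q_ge_2 by (intro mult_right_mono) auto
    with Suc show ?case
      by simp
  qed simp
  have "real (card (\<Union>n\<le>N. level n)) = (\<Sum>n\<le>N. real (card (level n)))"
    by (subst card_UN_disjoint) (use disj in auto)
  also have "\<dots> \<le> (\<Sum>n\<le>N. 2 * real q ^ n)"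
    by (intro sum_mono card_level_le)
  also have "\<dots> \<le> 4 * real q ^ N"
    using geo by (simp add: sum_distrib_left[symmetric])
  finally have card: "card (\<Union>n\<le>N. level n) / real q ^ N \<le> 4"
    using q_ge_2 by (simp add: field_simps)
  have "(\<Sum>n\<le>N. \<Sum>x\<in>level n. (cmod (u x))\<^sup>2) = (\<Sum>x\<in>(\<Union>n\<le>N. level n). (cmod (u x))\<^sup>2)"
    by (rule sum.UNION_disjoint[symmetric]) (use disj in auto)
  also have "\<dots> \<le> A\<^sup>2 * (real q * real N + card (\<Union>n\<le>N. level n) / real q ^ N)"
    using q_ge_2 by (intro sum_square_le_weak_L2_bound[OF u A]) auto
  also have "\<dots> \<le> A\<^sup>2 * (real q * real N + 4)"
    using card by (intro mult_left_mono) auto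
  finally show ?thesis .
qed

end

section \<open>Eigenfunctions of the Laplacian as martingales\<close>

context rooted_tree
begin

lemma gdist_neighbours: "{y. gdist adj x y = 1} = {y. adj x y}"
  using gdist_eq_1_iff by auto

lemma martingale_iff: "martingale m \<longleftrightarrow> (\<forall>x. (\<Sum>y\<in>children x. m y) = of_nat (card (children x)) * m x)"
proof -
  have "(\<Sum>y\<in>children x. mass y *\<^sub>R m y) = mass x *\<^sub>R m x \<longleftrightarrow>
        (\<Sum>y\<in>children x. m y) = of_nat (card (children x)) * m x" for x
  proof -
    define k where "k = card (children x)"
    have sum_eq: "(\<Sum>y\<in>children x. mass y *\<^sub>R m y) = (mass x / k) *\<^sub>R (\<Sum>y\<in>children x. m y)"
      by (simp add: mass_child scaleR_sum_right k_def)
    have "k > 0" "mass x > 0"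
      using mass_pos[of x] card_children_pos[of x] by (simp_all add: k_def)
    then show ?thesis
      unfolding sum_eq k_def[symmetric] by (simp add: scaleR_conv_of_real field_simps)
  qed
  then show ?thesis
    by (simp add: martingale_def)
qed

end

locale spectral_tree = rooted_tree adj q x\<^sub>0
  for adj :: "'v \<Rightarrow> 'v \<Rightarrow> bool" and q :: nat and x\<^sub>0 :: 'v +
  fixes z :: real
  assumes z_notin: "z \<notin> {tau q / 2 * of_int k | k :: int. True}"
begin

text \<open>\<open>base\<close> is \<open>q\<^sup>1\<^sup>/\<^sup>2\<^sup>+\<^sup>i\<^sup>z\<close> and \<open>phase\<close> is \<open>w = q\<^sup>2\<^sup>i\<^sup>z\<close>. The constant \<open>kappa\<close> is the one for which the increment of the
  renormalised Poisson kernel, integrated over a shadow of mass \<open>mass x\<close>, equals \<open>kappa * phase ^ lev x\<close>.\<close>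

definition base :: complex where
  "base = of_nat q powr (1/2 + \<i> * of_real z)"

definition phase :: complex where
  "phase = base\<^sup>2 / of_nat q"

definition kappa :: complex where
  "kappa = (of_nat q * phase - 1) / ((of_nat q + 1) * phase)"

text \<open>\<open>V\<close> accumulates \<open>kappa * phase ^ n * m\<close> along the path from the root. It stands for the renormalised
  function \<open>x \<mapsto> base ^ lev x * u x\<close>.\<close>

definition potential :: "('v \<Rightarrow> complex) \<Rightarrow> ('v \<Rightarrow> complex) \<Rightarrow> bool" where
  "potential m V \<longleftrightarrow> V x\<^sub>0 = m x\<^sub>0 \<and>
     (\<forall>x. x \<noteq> x\<^sub>0 \<longrightarrow> V x = V (par x) + kappa * phase ^ lev x * m x)"

lemma base_nonzero [simp]: "base \<noteq> 0"
  using q_ge_2 by (simp add: base_def)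

lemma cmod_base: "cmod base = sqrt q"
  unfolding base_def using q_ge_2 by (subst norm_powr_real_powr) (auto simp: powr_half_sqrt)

lemma base_squared: "base\<^sup>2 = of_nat q * phase"
  using q_ge_2 by (simp add: phase_def)

lemma cmod_phase [simp]: "cmod phase = 1"
  using q_ge_2 by (simp add: phase_def norm_divide norm_power cmod_base)

lemma phase_nonzero [simp]: "phase \<noteq> 0"
  using cmod_phase by (metis norm_zero zero_neq_one)

text \<open>The equation \<open>q\<^sup>2\<^sup>i\<^sup>z = 1\<close> means that \<open>2 z log q\<close> is a multiple of \<open>2 \<pi>\<close>, that is \<open>z \<in> (\<tau>/2) \<int>\<close>.\<close>

lemma phase_neq_1: "phase \<noteq> 1"
proof
  assume "phase = 1"
  have q: "of_nat q \<noteq> (0::complex)" "ln (real q) > 0"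
    using q_ge_2 by auto
  have "base\<^sup>2 = of_nat q powr (1 + 2 * \<i> * of_real z)"
    by (simp add: base_def power2_eq_square powr_add[symmetric] algebra_simps)
  also have "\<dots> = of_nat q * of_nat q powr (2 * \<i> * of_real z)"
    using q by (simp add: powr_add)
  finally have "of_nat q powr (2 * \<i> * of_real z) = 1"
    using \<open>phase = 1\<close> q by (simp add: phase_def)
  then have "exp (2 * \<i> * of_real z * of_real (ln (real q))) = 1"
    using q q_ge_2 by (simp add: powr_def Ln_of_nat)
  then obtain n :: int where "2 * z * ln (real q) = of_int (2 * n) * pi"
    by (auto simp: exp_eq_1)
  then have "z = tau q / 2 * of_int n"
    using q by (simp add: tau_def field_simps)
  then show False
    using z_notin by blast
qed

text \<open>Here \<open>\<bar>q w\<bar> = q > 1\<close>.\<close>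

lemma kappa_nonzero: "kappa \<noteq> 0"
proof -
  have "of_nat q * phase \<noteq> 1"
  proof
    assume "of_nat q * phase = 1"
    then have "cmod (of_nat q * phase) = 1"
      by simp
    then show False
      using q_ge_2 by (simp add: norm_mult)
  qed
  moreover have "of_nat q + 1 \<noteq> (0 :: complex)"
    by (metis of_nat_Suc of_nat_neq_0 add.commute)
  ultimately show ?thesis
    by (simp add: kappa_def)
qed

lemma kappa_phase: "(of_nat q + 1) * (kappa * phase) = of_nat q * phase - 1"
proof -
  have "of_nat q + 1 \<noteq> (0 :: complex)"
    by (metis of_nat_Suc of_nat_neq_0 add.commute)
  then show ?thesis
    by (simp add: kappa_def)
qed

lemma potentialD:
  assumes "potential m V"
  shows "V x\<^sub>0 = m x\<^sub>0" "x \<noteq> x\<^sub>0 \<Longrightarrow> V x = V (par x) + kappa * phase ^ lev x * m x"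
  using assms by (auto simp: potential_def)

lemma potential_unique:
  assumes "potential m V" "potential m V'"
  shows "V x = V' x"
proof (induction "lev x" arbitrary: x)
  case 0
  then show ?case
    using potentialD(1)[OF assms(1)] potentialD(1)[OF assms(2)] by simp
next
  case (Suc n)
  then have x: "x \<noteq> x\<^sub>0"
    by auto
  then have "V (par x) = V' (par x)"
    using Suc lev_par[OF x] by simp
  then show ?case
    using potentialD(2)[OF assms(1) x] potentialD(2)[OF assms(2) x] by simp
qed

lemma ex_martingale_of_potential: "\<exists>m. potential m V"
  by (rule exI[of _ "\<lambda>x. if x = x\<^sub>0 then V x else (V x - V (par x)) / (kappa * phase ^ lev x)"])
     (simp add: potential_def kappa_nonzero)

lemma eigenvalue: "(of_nat q + 1) * eigenvalue_gamma q (of_real z) = base + of_nat q / base"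
proof -
  have "of_nat q powr (1/2 - \<i> * of_real z) = of_nat q powr (1 - (1/2 + \<i> * of_real z))"
    by simp
  also have "\<dots> = of_nat q / base"
    using q_ge_2 unfolding powr_diff base_def by simp
  finally have "of_nat q powr (1/2 - \<i> * of_real z) = of_nat q / base" .
  moreover have "of_nat q + 1 \<noteq> (0 :: complex)"
    by (metis of_nat_Suc of_nat_neq_0 add.commute)
  ultimately show ?thesis
    unfolding eigenvalue_gamma_def base_def[symmetric] by simp
qed

lemma eigen_iff:
  "laplacian adj q u x = eigenvalue_gamma q (of_real z) * u x \<longleftrightarrow>
   (\<Sum>y | adj x y. u y) = (base + of_nat q / base) * u x"
proof -
  have n: "of_nat q + 1 \<noteq> (0 :: complex)"
    by (metis of_nat_Suc of_nat_neq_0 add.commute)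
  then have "laplacian adj q u x = eigenvalue_gamma q (of_real z) * u x \<longleftrightarrow>
      (\<Sum>y | adj x y. u y) = (of_nat q + 1) * eigenvalue_gamma q (of_real z) * u x"
    unfolding laplacian_def gdist_neighbours by (auto simp: field_simps)
  then show ?thesis
    by (simp only: eigenvalue)
qed

text \<open>The eigenvalue equation at \<open>x\<close>, multiplied by \<open>base ^ Suc (lev x)\<close>, involves \<open>V\<close> at \<open>x\<close>, at its parent
  and at its children. Expressing the neighbouring values by the recursion, all terms containing \<open>V x\<close>
  cancel and the mean value property of \<open>m\<close> at \<open>x\<close> remains, up to a nonzero factor. At the root
  the term from the parent is missing, and the value of \<open>kappa\<close> makes up for it.\<close>

lemma eigenfunction_iff_martingale:
  assumes V: "potential m V" and u: "\<And>x. V x = base ^ lev x * u x"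
  shows "(\<forall>x. laplacian adj q u x = eigenvalue_gamma q (of_real z) * u x) \<longleftrightarrow> martingale m"
proof -
  have u_eq: "u x = V x / base ^ lev x" for x
    by (simp add: u)
  have "(\<Sum>y | adj x y. u y) = (base + of_nat q / base) * u x \<longleftrightarrow>
        (\<Sum>y\<in>children x. m y) = of_nat (card (children x)) * m x" for x
  proof -
    define n where "n = lev x"
    define S where "S = (\<Sum>y\<in>children x. m y)"
    have "base ^ Suc n * (\<Sum>y\<in>children x. u y) = (\<Sum>y\<in>children x. V y)"
      unfolding sum_distrib_left using children_imp(3)[of _ x] by (intro sum.cong) (simp_all add: u n_def)
    also have "\<dots> = (\<Sum>y\<in>children x. V x + kappa * phase ^ Suc n * m y)"
      using children_imp[of _ x] potentialD(2)[OF V] by (intro sum.cong) (simp_all add: n_def)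
    also have "\<dots> = of_nat (card (children x)) * V x + kappa * phase ^ Suc n * S"
      by (simp add: sum.distrib sum_distrib_left S_def)
    finally have children_sum:
      "base ^ Suc n * (\<Sum>y\<in>children x. u y) = of_nat (card (children x)) * V x + kappa * phase ^ Suc n * S" .
    have rhs: "base ^ Suc n * ((base + of_nat q / base) * u x) = (base\<^sup>2 + of_nat q) * V x"
      by (simp add: u_eq n_def[symmetric] field_simps power2_eq_square)
    have scale: "a = b \<longleftrightarrow> base ^ Suc n * a = base ^ Suc n * b" for a b
      by simp
    show ?thesis
    proof (cases "x = x\<^sub>0")
      case True
      then have n: "n = 0" and card: "of_nat (card (children x)) = (of_nat q + 1 :: complex)"
        and Vx: "V x = m x" and nb: "{y. adj x y} = children x"
        using card_children_root potentialD(1)[OF V] neighbours_root by (simp_all add: n_def)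
      have "(\<Sum>y | adj x y. u y) = (base + of_nat q / base) * u x \<longleftrightarrow>
          base ^ Suc n * (\<Sum>y | adj x y. u y) = base ^ Suc n * ((base + of_nat q / base) * u x)"
        by (rule scale)
      also have "\<dots> \<longleftrightarrow> (of_nat q + 1) * m x + kappa * phase * S = (of_nat q * phase + of_nat q) * m x"
        unfolding rhs nb children_sum
        by (simp add: n card Vx base_squared)
      also have "\<dots> \<longleftrightarrow> kappa * phase * S = (of_nat q * phase - 1) * m x"
        by (auto simp: algebra_simps)
      also have "\<dots> \<longleftrightarrow> kappa * phase * S = kappa * phase * ((of_nat q + 1) * m x)"
        unfolding kappa_phase[symmetric] by (simp add: mult_ac)
      also have "\<dots> \<longleftrightarrow> S = (of_nat q + 1) * m x"
        by (simp add: kappa_nonzero)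
      finally show ?thesis
        by (simp add: card S_def)
    next
      case False
      then obtain k where k: "n = Suc k" "lev (par x) = k"
        using lev_par[OF False] by (simp add: n_def)
      have "base ^ Suc n * u (par x) = base\<^sup>2 * V (par x)"
        by (simp add: u_eq k power2_eq_square)
      also have "V (par x) = V x - kappa * phase ^ n * m x"
        using potentialD(2)[OF V False] by (simp add: n_def)
      finally have par_term: "base ^ Suc n * u (par x) = base\<^sup>2 * (V x - kappa * phase ^ n * m x)" .
      have "(\<Sum>y | adj x y. u y) = u (par x) + (\<Sum>y\<in>children x. u y)"
        using neighbours[OF False] by simp
      then have "base ^ Suc n * (\<Sum>y | adj x y. u y) =
          base\<^sup>2 * (V x - kappa * phase ^ n * m x) + (of_nat q * V x + kappa * phase ^ Suc n * S)"
        using children_sum par_term card_children[OF False] by (simp only: distrib_left)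
      then have "(\<Sum>y | adj x y. u y) = (base + of_nat q / base) * u x \<longleftrightarrow>
          base\<^sup>2 * (V x - kappa * phase ^ n * m x) + (of_nat q * V x + kappa * phase ^ Suc n * S)
            = (base\<^sup>2 + of_nat q) * V x"
        using rhs by (metis scale)
      also have "\<dots> \<longleftrightarrow> kappa * phase ^ Suc n * S = kappa * phase ^ Suc n * (of_nat q * m x)"
        unfolding base_squared by (auto simp: algebra_simps)
      also have "\<dots> \<longleftrightarrow> S = of_nat q * m x"
        by (simp add: kappa_nonzero)
      finally show ?thesis
        by (simp add: card_children[OF False] S_def)
    qed
  qed
  then show ?thesis
    by (simp add: eigen_iff martingale_iff)
qed

text \<open>The martingale \<open>S\<close> obtained from \<open>m\<close> by multiplying the increments by powers of the phase;
  \<open>conjugate_part_step\<close> is the summation by parts that justifies this description.\<close>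

definition conjugate_part :: "('v \<Rightarrow> complex) \<Rightarrow> ('v \<Rightarrow> complex) \<Rightarrow> 'v \<Rightarrow> complex" where
  "conjugate_part m V x = phase ^ Suc (lev x) * m x - (phase - 1) / kappa * V x"

lemma potential_eq_conjugate_part:
  "V x = kappa / (phase - 1) * (phase ^ Suc (lev x) * m x - conjugate_part m V x)"
  using kappa_nonzero phase_neq_1 by (simp add: conjugate_part_def)

lemma conjugate_part_step:
  assumes "potential m V" "x \<noteq> x\<^sub>0"
  shows "conjugate_part m V x = conjugate_part m V (par x) + phase ^ lev x * (m x - m (par x))"
proof -
  have "(phase - 1) / kappa * V x = (phase - 1) / kappa * V (par x) + (phase - 1) * phase ^ lev x * m x"
    using potentialD(2)[OF assms] kappa_nonzero by (simp add: distrib_left)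
  moreover have "Suc (lev (par x)) = lev x"
    using lev_par[OF assms(2)] by simp
  ultimately show ?thesis
    by (simp add: conjugate_part_def algebra_simps)
qed

lemma martingale_conjugate_part:
  assumes "potential m V" "martingale m"
  shows "martingale (conjugate_part m V)"
  unfolding martingale_def
proof
  fix x
  define S where "S = conjugate_part m V"
  have step: "S y = S x + phase ^ Suc (lev x) * (m y - m x)" if "y \<in> children x" for y
    using conjugate_part_step[OF assms(1), of y] children_imp[OF that] by (simp add: S_def)
  have "(\<Sum>y\<in>children x. mass y *\<^sub>R S y) =
      (\<Sum>y\<in>children x. mass y *\<^sub>R S x + phase ^ Suc (lev x) * (mass y *\<^sub>R m y - mass y *\<^sub>R m x))"
    by (intro sum.cong refl, subst step) (simp_all add: scaleR_conv_of_real algebra_simps)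
  also have "\<dots> = (\<Sum>y\<in>children x. mass y) *\<^sub>R S x
      + phase ^ Suc (lev x) * ((\<Sum>y\<in>children x. mass y *\<^sub>R m y) - (\<Sum>y\<in>children x. mass y) *\<^sub>R m x)"
    by (simp only: sum.distrib sum_distrib_left[symmetric] sum_subtractf scaleR_sum_left)
  also have "\<dots> = mass x *\<^sub>R S x"
    by (simp add: martingaleD[OF assms(2)] sum_mass_children)
  finally show "(\<Sum>y\<in>children x. mass y *\<^sub>R conjugate_part m V y) = mass x *\<^sub>R conjugate_part m V x"
    by (simp add: S_def)
qed

text \<open>The increments have the same absolute values as those of \<open>m\<close>, so only the energies at the root differ.\<close>

lemma energy_conjugate_part:
  assumes "potential m V" "martingale m"
  shows "energy (conjugate_part m V) n =
         energy m n + ((cmod (phase - (phase - 1) / kappa))\<^sup>2 - 1) * (cmod (m x\<^sub>0))\<^sup>2"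
proof (induction n)
  case 0
  have root: "conjugate_part m V x\<^sub>0 = (phase - (phase - 1) / kappa) * m x\<^sub>0"
    using potentialD(1)[OF assms(1)] by (simp add: conjugate_part_def algebra_simps)
  show ?case
    unfolding energy_def level_0 by (simp add: root norm_mult power_mult_distrib) (simp add: algebra_simps)
next
  case (Suc n)
  have "cmod (conjugate_part m V y - conjugate_part m V (par y)) = cmod (m y - m (par y))"
    if "y \<in> level (Suc n)" for y
  proof -
    have "y \<noteq> x\<^sub>0"
      using that by (auto simp: level_def)
    then show ?thesis
      by (subst conjugate_part_step[OF assms(1)]) (auto simp: norm_mult norm_power)
  qed
  then show ?case
    using Suc unfolding energy_Suc[OF assms(2)] energy_Suc[OF martingale_conjugate_part[OF assms]]
    by simp
qed

text \<open>The squared weak type constant: 32 is the constant for a single martingale, the energies of \<open>m\<close> and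
  its conjugate part are at most \<open>1\<close> and \<open>c\<^sup>2 + 1\<close> times a bound for those of \<open>m\<close>, and dividing the threshold
  \<open>t\<close> by \<open>2 d\<close> costs a factor \<open>4 d\<^sup>2\<close>; here \<open>d\<close> and \<open>c\<close> are the two absolute values in the formula.\<close>

definition weak_type_const :: real where
  "weak_type_const =
     128 * (cmod (kappa / (phase - 1)))\<^sup>2 * ((cmod (phase - (phase - 1) / kappa))\<^sup>2 + 2)"

lemma weak_type_const_pos: "weak_type_const > 0"
  using kappa_nonzero phase_neq_1 unfolding weak_type_const_def
  by (intro mult_pos_pos add_nonneg_pos) auto

text \<open>Where \<open>\<bar>u\<bar> > t\<close>, one of the martingales \<open>m\<close> and \<open>conjugate_part m V\<close> exceeds \<open>s q\<^sup>n\<^sup>/\<^sup>2\<close> with \<open>s = t / (2 d)\<close>,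
  \<open>d = \<bar>kappa / (phase - 1)\<bar>\<close>; both sets are small by the weak type bound.\<close>

lemma weak_L2_bound_of_martingale:
  assumes V: "potential m V" and u: "\<And>x. V x = base ^ lev x * u x"
    and m: "martingale m" and B: "\<And>n. energy m n \<le> B"
  shows "weak_L2_bound u (sqrt (weak_type_const * B))"
  unfolding weak_L2_bound_def
proof (intro allI impI)
  fix t :: real assume t: "t > 0"
  define S where "S = conjugate_part m V"
  define c where "c = cmod (phase - (phase - 1) / kappa)"
  define d where "d = cmod (kappa / (phase - 1))"
  define s where "s = t / (2 * d)"
  have d: "d > 0"
    using kappa_nonzero phase_neq_1 by (simp add: d_def)
  then have s: "s > 0"
    using t by (simp add: s_def)
  have B0: "B \<ge> 0"
    using B[of 0] energy_nonneg[of m 0] by linarith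
  have S: "martingale S" "energy S n \<le> (c\<^sup>2 + 1) * B" for n
  proof -
    show "martingale S"
      unfolding S_def by (rule martingale_conjugate_part[OF V m])
    have "(c\<^sup>2 - 1) * (cmod (m x\<^sub>0))\<^sup>2 \<le> c\<^sup>2 * (cmod (m x\<^sub>0))\<^sup>2"
      by (intro mult_right_mono) auto
    also have "\<dots> \<le> c\<^sup>2 * B"
      using B[of 0] by (intro mult_left_mono) (auto simp: energy_def level_0)
    finally show "energy S n \<le> (c\<^sup>2 + 1) * B"
      unfolding S_def energy_conjugate_part[OF V m] c_def[symmetric]
      using B[of n] by (simp add: algebra_simps)
  qed
  define X where "X = {x. s * sqrt q ^ lev x < cmod (m x)}"
  define Y where "Y = {x. s * sqrt q ^ lev x < cmod (S x)}"
  have X: "finite X" "s\<^sup>2 * card X \<le> 32 * B"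
    unfolding X_def using weak_type_martingale[OF m B s] by auto
  have Y: "finite Y" "s\<^sup>2 * card Y \<le> 32 * ((c\<^sup>2 + 1) * B)"
    unfolding Y_def using weak_type_martingale[OF S(1) S(2) s] by auto
  have sub: "{x. cmod (u x) > t} \<subseteq> X \<union> Y"
  proof
    fix x assume "x \<in> {x. cmod (u x) > t}"
    then have "t * sqrt q ^ lev x < cmod (u x) * sqrt q ^ lev x"
      using q_ge_2 by (intro mult_strict_right_mono) auto
    also have "\<dots> = cmod (V x)"
      by (simp add: u norm_mult norm_power cmod_base)
    also have "\<dots> = d * cmod (phase ^ Suc (lev x) * m x - S x)"
      unfolding d_def S_def norm_mult[symmetric] potential_eq_conjugate_part[symmetric] ..
    also have "\<dots> \<le> d * (cmod (m x) + cmod (S x))"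
      using d norm_triangle_ineq4[of "phase ^ Suc (lev x) * m x" "S x"]
      by (intro mult_left_mono) (auto simp: norm_mult norm_power)
    finally have "2 * (s * sqrt q ^ lev x) < cmod (m x) + cmod (S x)"
      using d by (simp add: s_def field_simps)
    then show "x \<in> X \<union> Y"
      unfolding X_def Y_def by auto
  qed
  have "card {x. cmod (u x) > t} \<le> card (X \<union> Y)"
    using X(1) Y(1) by (intro card_mono sub) auto
  also have "\<dots> \<le> card X + card Y"
    by (rule card_Un_le)
  finally have "s\<^sup>2 * card {x. cmod (u x) > t} \<le> s\<^sup>2 * (card X + card Y)"
    by (intro mult_left_mono) auto
  also have "\<dots> \<le> 32 * ((c\<^sup>2 + 2) * B)"
    using X(2) Y(2) by (simp add: algebra_simps)
  finally have "t\<^sup>2 * card {x. cmod (u x) > t} \<le> weak_type_const * B"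
    using d unfolding weak_type_const_def c_def[symmetric] d_def[symmetric] s_def
    by (simp add: power_divide power_mult_distrib field_simps)
  moreover have "finite {x. cmod (u x) > t}"
    using sub X(1) Y(1) finite_subset by blast
  ultimately show "finite {x. cmod (u x) > t} \<and>
      t\<^sup>2 * card {x. cmod (u x) > t} \<le> (sqrt (weak_type_const * B))\<^sup>2"
    using B0 weak_type_const_pos by simp
qed

text \<open>The recursion recovers \<open>m x\<close> from the values of \<open>u\<close> at \<open>x\<close> and its parent, and the factor \<open>q\<^sup>n\<close> in
  \<open>\<bar>V\<bar>\<^sup>2 = q\<^sup>n \<bar>u\<bar>\<^sup>2\<close> is absorbed by the mass.\<close>

lemma energy_Suc_le:
  assumes V: "potential m V" and u: "\<And>x. V x = base ^ lev x * u x"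
  shows "energy m (Suc n) \<le>
    2 / (cmod kappa)\<^sup>2 * ((\<Sum>x\<in>level (Suc n). (cmod (u x))\<^sup>2) + (\<Sum>x\<in>level n. (cmod (u x))\<^sup>2))"
proof -
  have mass_V: "mass x * (cmod (V x))\<^sup>2 \<le> (cmod (u x))\<^sup>2" for x
  proof -
    have "mass x * (cmod (V x))\<^sup>2 = (mass x * real q ^ lev x) * (cmod (u x))\<^sup>2"
      by (simp add: u norm_mult norm_power cmod_base power_mult_distrib power_mult[symmetric])
         (simp add: power_mult mult.commute[of _ 2])
    also have "\<dots> \<le> 1 * (cmod (u x))\<^sup>2"
      using mass_power_bounds(1) by (intro mult_right_mono) auto
    finally show ?thesis
      by simp
  qed
  have m_le: "(cmod kappa)\<^sup>2 * (cmod (m x))\<^sup>2 \<le> 2 * ((cmod (V x))\<^sup>2 + (cmod (V (par x)))\<^sup>2)"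
    if "x \<in> level (Suc n)" for x
  proof -
    have "x \<noteq> x\<^sub>0"
      using that by (auto simp: level_def)
    then have "V x - V (par x) = kappa * phase ^ lev x * m x"
      using potentialD(2)[OF V] by simp
    then have "cmod kappa * cmod (m x) = cmod (V x - V (par x))"
      by (simp add: norm_mult norm_power)
    also have "\<dots> \<le> cmod (V x) + cmod (V (par x))"
      by (rule norm_triangle_ineq4)
    finally have "(cmod kappa * cmod (m x))\<^sup>2 \<le> (cmod (V x) + cmod (V (par x)))\<^sup>2"
      by (intro power_mono) auto
    also have "\<dots> \<le> 2 * ((cmod (V x))\<^sup>2 + (cmod (V (par x)))\<^sup>2)"
      using zero_le_power2[of "cmod (V x) - cmod (V (par x))"]
      by (simp add: power2_eq_square algebra_simps)
    finally show ?thesis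
      by (simp add: power_mult_distrib)
  qed
  have "(cmod kappa)\<^sup>2 * energy m (Suc n) = (\<Sum>x\<in>level (Suc n). mass x * ((cmod kappa)\<^sup>2 * (cmod (m x))\<^sup>2))"
    by (simp add: energy_def sum_distrib_left mult_ac)
  also have "\<dots> \<le> (\<Sum>x\<in>level (Suc n). mass x * (2 * ((cmod (V x))\<^sup>2 + (cmod (V (par x)))\<^sup>2)))"
    by (intro sum_mono mult_left_mono m_le) auto
  also have "\<dots> = 2 * ((\<Sum>x\<in>level (Suc n). mass x * (cmod (V x))\<^sup>2) + (\<Sum>x\<in>level n. mass x * (cmod (V x))\<^sup>2))"
    unfolding sum_mass_level_par[of "\<lambda>x. (cmod (V x))\<^sup>2" n, symmetric]
    by (simp add: sum_distrib_left sum.distrib[symmetric] algebra_simps)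
  also have "\<dots> \<le> 2 * ((\<Sum>x\<in>level (Suc n). (cmod (u x))\<^sup>2) + (\<Sum>x\<in>level n. (cmod (u x))\<^sup>2))"
    by (intro mult_left_mono add_mono sum_mono mass_V) auto
  finally show ?thesis
    using kappa_nonzero by (simp add: field_simps)
qed

text \<open>On a single level the sum of \<open>\<bar>u\<bar>\<^sup>2\<close> could grow linearly. Averaging over the levels from \<open>N\<close> to \<open>2 N\<close>
  removes the growth, and the monotone energy is at most its later averages.\<close>

lemma energy_le_of_weak_L2_bound:
  assumes V: "potential m V" and u: "\<And>x. V x = base ^ lev x * u x"
    and m: "martingale m" and weak: "weak_L2_bound u A" and A: "A > 0"
  shows "energy m n \<le> 4 / (cmod kappa)\<^sup>2 * A\<^sup>2 * (2 * q + 4)"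
proof -
  define C where "C = 2 / (cmod kappa)\<^sup>2"
  define s where "s n = (\<Sum>x\<in>level n. (cmod (u x))\<^sup>2)" for n
  have C: "C \<ge> 0" and s: "s n \<ge> 0" for n
    by (auto simp: C_def s_def intro: sum_nonneg)
  have main: "energy m N \<le> 2 * C * A\<^sup>2 * (2 * q + 4)" if N: "N > 0" for N
  proof -
    have "N * energy m N = (\<Sum>k\<in>{N..<2 * N}. energy m N)"
      by simp
    also have "\<dots> \<le> (\<Sum>k\<in>{N..<2 * N}. C * (s (Suc k) + s k))"
    proof (rule sum_mono)
      fix k assume "k \<in> {N..<2 * N}"
      then have "energy m N \<le> energy m (Suc k)"
        by (intro energy_mono[OF m]) auto
      also have "\<dots> \<le> C * (s (Suc k) + s k)"
        unfolding C_def s_def by (rule energy_Suc_le[OF V u])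
      finally show "energy m N \<le> C * (s (Suc k) + s k)" .
    qed
    also have "\<dots> = C * ((\<Sum>k\<in>{Suc N..<Suc (2 * N)}. s k) + (\<Sum>k\<in>{N..<2 * N}. s k))"
      by (simp only: sum_distrib_left[symmetric] sum.distrib sum.shift_bounds_Suc_ivl)
    also have "\<dots> \<le> C * ((\<Sum>k\<le>2 * N. s k) + (\<Sum>k\<le>2 * N. s k))"
      using C s by (intro mult_left_mono add_mono sum_mono2) auto
    also have "\<dots> \<le> C * (A\<^sup>2 * (N * (2 * q + 4)) + A\<^sup>2 * (N * (2 * q + 4)))"
    proof -
      have "(\<Sum>k\<le>2 * N. s k) \<le> A\<^sup>2 * (real q * real (2 * N) + 4)"
        unfolding s_def using sum_levels_le_weak_L2_bound[OF weak A, of "2 * N"] by simp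
      also have "\<dots> \<le> A\<^sup>2 * (N * (2 * q + 4))"
        using N by (intro mult_left_mono) (auto simp: algebra_simps)
      finally show ?thesis
        using C by (intro mult_left_mono add_mono)
    qed
    finally have "N * energy m N \<le> N * (2 * C * A\<^sup>2 * (2 * q + 4))"
      by (simp add: algebra_simps)
    then show ?thesis
      using N by simp
  qed
  have "energy m n \<le> energy m (Suc n)"
    by (rule energy_mono[OF m]) simp
  also have "\<dots> \<le> 2 * C * A\<^sup>2 * (2 * q + 4)"
    by (rule main) simp
  finally show ?thesis
    by (simp add: C_def)
qed

end

section \<open>The Poisson transform\<close>

locale poisson_tree = tree_boundary adj q x\<^sub>0 \<nu> + spectral_tree adj q x\<^sub>0 z
  for adj :: "'v \<Rightarrow> 'v \<Rightarrow> bool" and q :: nat and x\<^sub>0 :: 'v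
    and \<nu> :: "(nat \<Rightarrow> 'v) measure" and z :: real
begin

lemma kernel_eq:
  "base ^ lev x * poisson_kernel_power adj q x\<^sub>0 (of_real z) x \<omega> = (base\<^sup>2) ^ lev (confluence adj x\<^sub>0 x \<omega>)"
proof -
  define c where "c = lev (confluence adj x\<^sub>0 x \<omega>)"
  have "poisson_kernel_power adj q x\<^sub>0 (of_real z) x \<omega> = base powi (int (2 * c) - int (lev x))"
    using q_ge_2
    by (simp add: poisson_kernel_power_def base_def powr_def height_def lev_def[symmetric] c_def
        exp_power_int mult_ac)
  also have "\<dots> = base ^ (2 * c) / base ^ lev x"
    by (simp only: power_int_diff base_nonzero simp_thms power_int_of_nat)
  finally show ?thesis
    by (simp add: c_def power_mult)
qed

lemma kernel_root:
  "\<omega> \<in> space \<nu> \<Longrightarrow> poisson_kernel_power adj q x\<^sub>0 (of_real z) x\<^sub>0 \<omega> = 1"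
  using kernel_eq[of x\<^sub>0 \<omega>] confluence_root by (simp add: space_boundary)

text \<open>The confluence point changes from the parent to \<open>x\<close> only for rays through \<open>x\<close>, for which it moves from
  the parent to \<open>x\<close> itself.\<close>

lemma kernel_step:
  assumes "x \<noteq> x\<^sub>0" "\<omega> \<in> space \<nu>"
  shows "base ^ lev x * poisson_kernel_power adj q x\<^sub>0 (of_real z) x \<omega> =
         base ^ lev (par x) * poisson_kernel_power adj q x\<^sub>0 (of_real z) (par x) \<omega>
         + ((base\<^sup>2) ^ lev x - (base\<^sup>2) ^ lev (par x)) * indicator (shadow adj x\<^sub>0 x) \<omega>"
proof (cases "\<omega> \<in> shadow adj x\<^sub>0 x")
  case True
  then have "\<omega> \<in> shadow adj x\<^sub>0 (par x)"
    using shadow_par[OF assms(1)] by blast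
  then show ?thesis
    using True unfolding kernel_eq by (simp add: confluence_shadow)
next
  case False
  then show ?thesis
    using assms unfolding kernel_eq by (simp add: confluence_par space_boundary)
qed

lemma step_coefficient:
  assumes "x \<noteq> x\<^sub>0"
  shows "((base\<^sup>2) ^ lev x - (base\<^sup>2) ^ lev (par x)) * of_real (mass x) = kappa * phase ^ lev x"
proof -
  obtain n where n: "lev x = Suc n" "lev (par x) = n"
    using lev_par[OF assms] by blast
  have q1: "of_nat q + 1 \<noteq> (0 :: complex)" "of_nat q \<noteq> (0 :: complex)"
    using q_ge_2 by (metis of_nat_Suc of_nat_neq_0 add.commute) (use q_ge_2 in simp)
  have "((base\<^sup>2) ^ Suc n - (base\<^sup>2) ^ n) * of_real (mass x) =
      (of_nat q * phase) ^ n * (of_nat q * phase - 1) * (of_nat q / ((of_nat q + 1) * of_nat q ^ Suc n))"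
    unfolding base_squared using assms by (simp add: mass_def n algebra_simps)
  also have "\<dots> = (of_nat q * phase - 1) / (of_nat q + 1) * phase ^ n"
  proof -
    have "(Q * P) * Y * (c / (a * (c * Q))) = Y / a * P" if "a \<noteq> 0" "c \<noteq> 0" "Q \<noteq> 0" for a c P Q Y :: complex
      using that by (simp add: field_simps)
    then show ?thesis
      using q1 by (simp only: power_mult_distrib power_Suc) simp
  qed
  also have "\<dots> = kappa * phase ^ Suc n"
    using q1 by (simp add: kappa_def)
  finally show ?thesis
    by (simp add: n)
qed

abbreviation transform :: "((nat \<Rightarrow> 'v) \<Rightarrow> complex) \<Rightarrow> 'v \<Rightarrow> complex" where
  "transform \<equiv> poisson_transform adj q x\<^sub>0 \<nu> (of_real z)"

lemma integrable_kernel: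
  assumes F: "integrable \<nu> F"
  shows "integrable \<nu> (\<lambda>\<omega>. poisson_kernel_power adj q x\<^sub>0 (of_real z) x \<omega> * F \<omega>)"
proof -
  have "integrable \<nu> (\<lambda>\<omega>. base ^ lev x * poisson_kernel_power adj q x\<^sub>0 (of_real z) x \<omega> * F \<omega>)"
  proof (induction "lev x" arbitrary: x)
    case 0
    then have "x = x\<^sub>0"
      by simp
    have "integrable \<nu> (\<lambda>\<omega>. base ^ lev x\<^sub>0 * poisson_kernel_power adj q x\<^sub>0 (of_real z) x\<^sub>0 \<omega> * F \<omega>)
        \<longleftrightarrow> integrable \<nu> F"
      by (intro Bochner_Integration.integrable_cong) (simp_all add: kernel_root)
    then show ?case
      using F \<open>x = x\<^sub>0\<close> by simp
  next
    case (Suc n)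
    then have x: "x \<noteq> x\<^sub>0"
      by auto
    let ?c = "(base\<^sup>2) ^ lev x - (base\<^sup>2) ^ lev (par x)"
    have "integrable \<nu> (\<lambda>\<omega>. base ^ lev x * poisson_kernel_power adj q x\<^sub>0 (of_real z) x \<omega> * F \<omega>)
        \<longleftrightarrow> integrable \<nu> (\<lambda>\<omega>. base ^ lev (par x) * poisson_kernel_power adj q x\<^sub>0 (of_real z) (par x) \<omega> * F \<omega>
              + ?c * (indicator (shadow adj x\<^sub>0 x) \<omega> *\<^sub>R F \<omega>))"
      by (intro Bochner_Integration.integrable_cong refl, subst kernel_step[OF x])
         (auto simp: algebra_simps scaleR_conv_of_real indicator_def)
    also have "\<dots>"
      using Suc lev_par[OF x] F
      by (intro Bochner_Integration.integrable_add integrable_mult_right integrable_mult_indicator) auto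
    finally show ?case .
  qed
  then have "integrable \<nu> (\<lambda>\<omega>. inverse (base ^ lev x) *
      (base ^ lev x * poisson_kernel_power adj q x\<^sub>0 (of_real z) x \<omega> * F \<omega>))"
    by (rule integrable_mult_right)
  then show ?thesis
    by (simp add: mult.assoc[symmetric])
qed

text \<open>Integrating \<open>kernel_step\<close> against \<open>F\<close> gives the recursion.\<close>

lemma potential_transform:
  assumes F: "integrable \<nu> F"
  shows "potential (shadow_avg F) (\<lambda>x. base ^ lev x * transform F x)"
  unfolding potential_def
proof (intro conjI allI impI)
  have "transform F x\<^sub>0 = (\<integral>\<omega>. F \<omega> \<partial>\<nu>)"
    unfolding poisson_transform_def
    by (intro Bochner_Integration.integral_cong) (simp_all add: kernel_root)
  also have "\<dots> = shadow_avg F x\<^sub>0"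
    using integral_eq_sum_level[OF F, of 0] by (simp add: level_0 shadow_integral_eq)
  finally show "base ^ lev x\<^sub>0 * transform F x\<^sub>0 = shadow_avg F x\<^sub>0"
    by simp
next
  fix x assume x: "x \<noteq> x\<^sub>0"
  let ?c = "(base\<^sup>2) ^ lev x - (base\<^sup>2) ^ lev (par x)"
  let ?k = "\<lambda>x \<omega>. poisson_kernel_power adj q x\<^sub>0 (of_real z) x \<omega>"
  have "base ^ lev x * transform F x = (\<integral>\<omega>. base ^ lev x * (?k x \<omega> * F \<omega>) \<partial>\<nu>)"
    unfolding poisson_transform_def by simp
  also have "\<dots> = (\<integral>\<omega>. base ^ lev (par x) * (?k (par x) \<omega> * F \<omega>)
      + ?c * (indicator (shadow adj x\<^sub>0 x) \<omega> *\<^sub>R F \<omega>) \<partial>\<nu>)"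
    by (intro Bochner_Integration.integral_cong refl, subst mult.assoc[symmetric], subst kernel_step[OF x])
       (auto simp: algebra_simps scaleR_conv_of_real indicator_def)
  also have "\<dots> = base ^ lev (par x) * transform F (par x) + ?c * (LINT \<omega>:shadow adj x\<^sub>0 x|\<nu>. F \<omega>)"
    unfolding poisson_transform_def set_lebesgue_integral_def
    using integrable_kernel[OF F, of "par x"] integrable_mult_indicator[OF shadow_sets F, of x]
    by (subst Bochner_Integration.integral_add) (simp_all del: mult_scaleR_right)
  also have "?c * (LINT \<omega>:shadow adj x\<^sub>0 x|\<nu>. F \<omega>) = kappa * phase ^ lev x * shadow_avg F x"
    unfolding shadow_integral_eq step_coefficient[OF x, symmetric] by (simp add: scaleR_conv_of_real mult_ac)
  finally show "base ^ lev x * transform F x =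
      base ^ lev (par x) * transform F (par x) + kappa * phase ^ lev x * shadow_avg F x" .
qed

lemma weak_L2_norm_transform_le:
  assumes F: "F \<in> L2 \<nu>"
  shows "weak_L2_norm (transform F) \<le> ennreal (sqrt weak_type_const * L2_norm \<nu> F)"
proof -
  have Fi: "integrable \<nu> F"
    by (rule L2_integrable[OF F])
  have nonneg: "0 \<le> L2_norm \<nu> F"
    by (simp add: L2_norm_def)
  have "weak_L2_bound (transform F) (sqrt (weak_type_const * (L2_norm \<nu> F)\<^sup>2))"
    by (rule weak_L2_bound_of_martingale[OF potential_transform[OF Fi] refl
          martingale_shadow_avg[OF Fi] energy_shadow_avg_le[OF F]])
  then show ?thesis
    using nonneg weak_type_const_pos by (simp add: weak_L2_norm_le_iff real_sqrt_mult)
qed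

lemma transform_is_weak_eigenfunction:
  assumes F: "F \<in> L2 \<nu>"
  shows "transform F \<in> weak_L2"
    and "laplacian adj q (transform F) x = eigenvalue_gamma q (of_real z) * transform F x"
proof -
  show "transform F \<in> weak_L2"
    using weak_L2_norm_transform_le[OF F] unfolding weak_L2_def
    by (simp add: le_less_trans[OF _ ennreal_less_top])
  have Fi: "integrable \<nu> F"
    by (rule L2_integrable[OF F])
  show "laplacian adj q (transform F) x = eigenvalue_gamma q (of_real z) * transform F x"
    using eigenfunction_iff_martingale[OF potential_transform[OF Fi] refl] martingale_shadow_avg[OF Fi]
    by blast
qed

text \<open>The martingale read off from \<open>u\<close> is bounded in \<open>L\<^sup>2\<close>, so it consists of the means of some \<open>F\<close>; then \<open>u\<close> and the transform of \<open>F\<close>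
  solve the same recursion.\<close>

lemma weak_eigenfunction_is_transform:
  assumes weak: "u \<in> weak_L2"
    and eigen: "\<forall>x. laplacian adj q u x = eigenvalue_gamma q (of_real z) * u x"
  shows "\<exists>F \<in> L2 \<nu>. \<forall>x. u x = transform F x"
proof -
  define V where "V = (\<lambda>x. base ^ lev x * u x)"
  have u: "V x = base ^ lev x * u x" for x
    by (simp add: V_def)
  obtain m where V: "potential m V"
    using ex_martingale_of_potential by blast
  have m: "martingale m"
    using eigenfunction_iff_martingale[OF V u] eigen by blast
  obtain A where A: "weak_L2_bound u A" "A > 0"
    using weak weak_L2_iff by blast
  obtain F where F: "F \<in> L2 \<nu>" "shadow_avg F = m"
    using L2_bounded_martingale_closed[OF m energy_le_of_weak_L2_bound[OF V u m A]] by blast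
  have "base ^ lev x * transform F x = V x" for x
    using potential_unique[OF potential_transform[OF L2_integrable[OF F(1)], unfolded F(2)] V, of x] .
  then have "u x = transform F x" for x
    by (simp add: u)
  with F(1) show ?thesis
    by blast
qed

end

theorem theorem3p3:
  fixes adj :: "'v \<Rightarrow> 'v \<Rightarrow> bool" and q :: nat and x\<^sub>0 :: 'v
    and \<nu> :: "(nat \<Rightarrow> 'v) measure" and z :: real
  assumes "q \<ge> 2"
    and "homogeneous_tree adj q"
    and "is_boundary_measure adj q x\<^sub>0 \<nu>"
    and "z \<notin> {tau q / 2 * of_int k | k :: int. True}"
  shows "(\<forall>u :: 'v \<Rightarrow> complex.
            (\<exists>F \<in> L2 \<nu>. \<forall>x. u x = poisson_transform adj q x\<^sub>0 \<nu> (of_real z) F x) \<longleftrightarrow>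
            (u \<in> weak_L2 \<and> (\<forall>x. laplacian adj q u x = eigenvalue_gamma q (of_real z) * u x)))
       \<and> (\<exists>C::real. C > 0 \<and>
            (\<forall>F \<in> L2 \<nu>. weak_L2_norm (poisson_transform adj q x\<^sub>0 \<nu> (of_real z) F)
                        \<le> ennreal (C * L2_norm \<nu> F)))"
proof -
  interpret homogeneous_tree adj q
    by (rule assms(2))
  interpret poisson_tree adj q x\<^sub>0 \<nu> z
    by unfold_locales (use assms in auto)
  have "u \<in> weak_L2 \<and> (\<forall>x. laplacian adj q u x = eigenvalue_gamma q (of_real z) * u x)"
    if "F \<in> L2 \<nu>" "\<forall>x. u x = transform F x" for u F
  proof -
    have "u = transform F"
      using that(2) by (intro ext) simp
    then show ?thesis
      using transform_is_weak_eigenfunction[OF that(1)] by simp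
  qed
  moreover have "sqrt weak_type_const > 0"
    using weak_type_const_pos by simp
  ultimately show ?thesis
    using weak_eigenfunction_is_transform weak_L2_norm_transform_le by blast
qed

end
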